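(* Let $a,b$ be positive integers with $\gcd(a,b)=1$ and assume that at least one of them is greater than $1$. Let $\{F_i: 1\le i\le\lambda_6(ab)\}$ be a basis of $M_6(ab)$, where $\lambda_6(ab)=\dim M_6(ab)$, and let $A_i(n)$ be the $n$-th Fourier coefficient of $F_i$. Then there exist constants $\delta_i$, $1\le i\le\lambda_6(ab)$, such that for all integers $n\ge2$ $$\begin{aligned}\sum_{\substack{l,m\in\mathbb{N}\\ al+bm=n}} l\,\sigma(l)\sigma(m) &= \frac{1}{144a}\left(\frac{6}{b}n^2+3n-\frac{2an}{b}\right)\sigma(n/a) + \frac{1}{144a}\left(\frac{6}{a}n^2-3n+\frac{a}{3}\right)\sigma(n/b) - \frac{5}{216}\sigma_3(n/a)\\ &\quad + \frac{n}{2a}W_{a,b}(n) + \frac{5}{9}W^{1,3}_{b,a}(n) + \frac{a}{3b}S(n/a) + \frac{1}{6\cdot 576\,a}\sum_{i=1}^{\lambda_6(ab)}\delta_i A_i(n),\end{aligned}$$ where $S(x)=\sum_{l,m\in\mathbb{N},\ l+m=x} l\,\sigma(l)\sigma(m)$ for a positive integer $x$ and $S(x)=0$ if $x$ is not a positive integer.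
   Context: For $r\in\mathbb{N}$ and a positive integer $n$, $\sigma_r(n)=\sum_{d\mid n,\,d\in\mathbb{N}}d^r$, $\sigma(n)=\sigma_1(n)$, and $\sigma_r(x)=0$ if $x$ is not a positive integer. $W_{a,b}(n)=\sum_{l,m\in\mathbb{N},\ al+bm=n}\sigma(l)\sigma(m)$ and $W^{1,3}_{b,a}(n)=\sum_{l,m\in\mathbb{N},\ bl+am=n}\sigma(l)\sigma_3(m)$. $M_6(N)$ is the space of holomorphic modular forms of weight $6$ on $\Gamma_0(N)$ with trivial character; Fourier expansions are in $q=e^{2\pi i z}$. *)

theory Defs
  imports "HOL-Complex_Analysis.Complex_Analysis" "HOL-Library.Function_Algebras"
begin

definition div_sigma :: "nat \<Rightarrow> real \<Rightarrow> nat" where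
  "div_sigma r x = (if x \<in> \<nat> \<and> x > 0 then (\<Sum>d | d dvd nat \<lfloor>x\<rfloor>. d ^ r) else 0)"

definition sols :: "nat \<Rightarrow> nat \<Rightarrow> nat \<Rightarrow> (nat \<times> nat) set" where
  "sols a b n = {(l, m). l > 0 \<and> m > 0 \<and> a * l + b * m = n}"

text \<open>
  \<open>conv_W r s a b n\<close> is the convolution sum $W^{r,s}_{a,b}(n)$; the unadorned $W_{a,b}(n)$
  has \<open>r = s = 1\<close>.
\<close>

definition conv_W :: "nat \<Rightarrow> nat \<Rightarrow> nat \<Rightarrow> nat \<Rightarrow> nat \<Rightarrow> nat" where
  "conv_W r s a b n = (\<Sum>(l, m)\<in>sols a b n. div_sigma r (real l) * div_sigma s (real m))"

definition conv_S :: "real \<Rightarrow> nat" where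
  "conv_S x = (if x \<in> \<nat> \<and> x > 0
     then (\<Sum>(l, m)\<in>sols 1 1 (nat \<lfloor>x\<rfloor>). l * div_sigma 1 (real l) * div_sigma 1 (real m)) else 0)"

definition upper_half_plane :: "complex set" where
  "upper_half_plane = {z. Im z > 0}"

text \<open>The weight-\<open>k\<close> action of the integer matrix with rows \<open>(a, b)\<close> and \<open>(c, d)\<close>.\<close>

definition slash :: "int \<Rightarrow> int \<Rightarrow> int \<Rightarrow> int \<Rightarrow> int \<Rightarrow> (complex \<Rightarrow> complex) \<Rightarrow> complex \<Rightarrow> complex" where
  "slash k a b c d f z =
     (of_int c * z + of_int d) powi (- k) * f ((of_int a * z + of_int b) / (of_int c * z + of_int d))"

text \<open>
  Holomorphic modular forms of weight \<open>k\<close> on $\Gamma_0(N)$ with trivial character. Since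
  $SL_2(\mathbb{Z})$ permutes the cusps transitively, holomorphy at all cusps is the boundedness
  of every translate \<open>f|\<gamma>\<close>, \<open>\<gamma>\<close> in $SL_2(\mathbb{Z})$, as \<open>Im z\<close> tends to infinity.
  A form is a function on the upper half plane; it is represented by its extension by 0 to the
  whole plane, so that linear independence and dimension are those of the function space.
\<close>

definition modular_forms :: "int \<Rightarrow> nat \<Rightarrow> (complex \<Rightarrow> complex) set" where
  "modular_forms k N = {f.
     (\<forall>z. z \<notin> upper_half_plane \<longrightarrow> f z = 0) \<and>
     f holomorphic_on upper_half_plane \<and>
     (\<forall>a b c d. a * d - b * c = 1 \<and> int N dvd c \<longrightarrow>
        (\<forall>z\<in>upper_half_plane. slash k a b c d f z = f z)) \<and>
     (\<forall>a b c d. a * d - b * c = 1 \<longrightarrow>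
        (\<exists>B Y. \<forall>z\<in>upper_half_plane. Im z \<ge> Y \<longrightarrow> norm (slash k a b c d f z) \<le> B))}"

text \<open>The coefficients of the expansion in $q = e^{2\pi i z}$, which are unique when they exist.\<close>

definition fourier_coeff :: "(complex \<Rightarrow> complex) \<Rightarrow> nat \<Rightarrow> complex" where
  "fourier_coeff f =
     (THE c. \<forall>z\<in>upper_half_plane. (\<lambda>n. c n * exp (2 * of_real pi * \<i> * z) ^ n) sums f z)"

definition scale_fun :: "complex \<Rightarrow> (complex \<Rightarrow> complex) \<Rightarrow> complex \<Rightarrow> complex" where
  "scale_fun c f = (\<lambda>z. c * f z)"

global_interpretation cfun: vector_space scale_fun
  by unfold_locales (auto simp: scale_fun_def fun_eq_iff algebra_simps)

lemma modular_forms_slash: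
  assumes "f \<in> modular_forms k N" "a * d - b * c = 1" "int N dvd c" "z \<in> upper_half_plane"
  shows "slash k a b c d f z = f z"
proof -
  have "\<forall>a b c d. a * d - b * c = 1 \<and> int N dvd c \<longrightarrow>
          (\<forall>z\<in>upper_half_plane. slash k a b c d f z = f z)"
    using assms(1) unfolding modular_forms_def by (elim CollectE conjE)
  from this[THEN spec, THEN spec, THEN spec, THEN spec, THEN mp, OF conjI, OF assms(2,3)]
  show ?thesis using assms(4) by (rule bspec)
qed

lemma modular_forms_bounded:
  assumes "f \<in> modular_forms k N" "a * d - b * c = 1"
  obtains B Y where "\<And>z. z \<in> upper_half_plane \<Longrightarrow> Im z \<ge> Y \<Longrightarrow> norm (slash k a b c d f z) \<le> B"
proof -
  have "\<forall>a b c d. a * d - b * c = 1 \<longrightarrow>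
          (\<exists>B Y. \<forall>z\<in>upper_half_plane. Im z \<ge> Y \<longrightarrow> norm (slash k a b c d f z) \<le> B)"
    using assms(1) unfolding modular_forms_def by (elim CollectE conjE)
  from this[THEN spec, THEN spec, THEN spec, THEN spec, THEN mp, OF assms(2)]
  show thesis using that by (elim exE) blast
qed

lemma subspace_modular_forms: "cfun.subspace (modular_forms k N)"
proof (rule cfun.subspaceI)
  show "0 \<in> modular_forms k N"
    unfolding modular_forms_def
  proof (intro CollectI conjI allI impI ballI)
    show "(0 :: complex \<Rightarrow> complex) holomorphic_on upper_half_plane"
      by (simp add: zero_fun_def)
    show "\<exists>B Y. \<forall>z\<in>upper_half_plane. Im z \<ge> Y \<longrightarrow> norm (slash k a b c d 0 z) \<le> B" for a b c d
      by (rule exI[of _ 0]) (simp add: slash_def)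
  qed (simp_all add: slash_def)
next
  fix f g assume f: "f \<in> modular_forms k N" and g: "g \<in> modular_forms k N"
  have sl: "slash k a b c d (f + g) z = slash k a b c d f z + slash k a b c d g z" for a b c d z
    by (simp add: slash_def distrib_left)
  show "f + g \<in> modular_forms k N"
    unfolding modular_forms_def
  proof (intro CollectI conjI allI impI ballI)
    show "(f + g) z = 0" if "z \<notin> upper_half_plane" for z
      using f g that by (simp add: modular_forms_def)
    have "f holomorphic_on upper_half_plane" "g holomorphic_on upper_half_plane"
      using f g by (simp_all add: modular_forms_def)
    then show "f + g holomorphic_on upper_half_plane"
      unfolding plus_fun_def by (rule holomorphic_on_add)
    fix a b c d
    show "slash k a b c d (f + g) z = (f + g) z"
      if "a * d - b * c = 1 \<and> int N dvd c" "z \<in> upper_half_plane" for z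
    proof -
      have "slash k a b c d f z = f z" "slash k a b c d g z = g z"
        using modular_forms_slash f g that by simp_all
      then show ?thesis by (simp add: sl)
    qed
    assume det: "a * d - b * c = 1"
    obtain B Y where 1: "\<And>z. z \<in> upper_half_plane \<Longrightarrow> Im z \<ge> Y \<Longrightarrow> norm (slash k a b c d f z) \<le> B"
      by (rule modular_forms_bounded[OF f det]) blast
    obtain B' Y' where 2: "\<And>z. z \<in> upper_half_plane \<Longrightarrow> Im z \<ge> Y' \<Longrightarrow> norm (slash k a b c d g z) \<le> B'"
      by (rule modular_forms_bounded[OF g det]) blast
    show "\<exists>B Y. \<forall>z\<in>upper_half_plane. Im z \<ge> Y \<longrightarrow> norm (slash k a b c d (f + g) z) \<le> B"
    proof (intro exI ballI impI)
      fix z assume "z \<in> upper_half_plane" "Im z \<ge> max Y Y'"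
      then show "norm (slash k a b c d (f + g) z) \<le> B + B'"
        unfolding sl using 1 2 by (intro norm_triangle_mono) simp_all
    qed
  qed
next
  fix r f assume f: "f \<in> modular_forms k N"
  have sl: "slash k a b c d (scale_fun r f) z = r * slash k a b c d f z" for a b c d z
    by (simp add: slash_def scale_fun_def)
  show "scale_fun r f \<in> modular_forms k N"
    unfolding modular_forms_def
  proof (intro CollectI conjI allI impI ballI)
    show "scale_fun r f z = 0" if "z \<notin> upper_half_plane" for z
      using f that by (simp add: modular_forms_def scale_fun_def)
    have "f holomorphic_on upper_half_plane"
      using f by (simp add: modular_forms_def)
    then show "scale_fun r f holomorphic_on upper_half_plane"
      unfolding scale_fun_def by (intro holomorphic_intros)
    fix a b c d
    show "slash k a b c d (scale_fun r f) z = scale_fun r f z"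
      if "a * d - b * c = 1 \<and> int N dvd c" "z \<in> upper_half_plane" for z
    proof -
      have "slash k a b c d f z = f z"
        using modular_forms_slash f that by simp
      then show ?thesis by (simp add: sl) (simp add: scale_fun_def)
    qed
    assume det: "a * d - b * c = 1"
    obtain B Y where 1: "\<And>z. z \<in> upper_half_plane \<Longrightarrow> Im z \<ge> Y \<Longrightarrow> norm (slash k a b c d f z) \<le> B"
      by (rule modular_forms_bounded[OF f det]) blast
    show "\<exists>B Y. \<forall>z\<in>upper_half_plane. Im z \<ge> Y \<longrightarrow> norm (slash k a b c d (scale_fun r f) z) \<le> B"
    proof (intro exI ballI impI)
      fix z assume "z \<in> upper_half_plane" "Im z \<ge> Y"
      then show "norm (slash k a b c d (scale_fun r f) z) \<le> norm r * B"
        unfolding sl norm_mult using 1 by (intro mult_left_mono) simp_all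
    qed
  qed
qed

definition lam :: "int \<Rightarrow> nat \<Rightarrow> nat" where
  "lam k N = cfun.dim (modular_forms k N)"

definition is_basis :: "(nat \<Rightarrow> complex \<Rightarrow> complex) \<Rightarrow> nat set \<Rightarrow> (complex \<Rightarrow> complex) set \<Rightarrow> bool" where
  "is_basis F I V \<longleftrightarrow> inj_on F I \<and> cfun.independent (F ` I) \<and> cfun.span (F ` I) = V"

end

theory Submission
  imports Defs
begin

text \<open>
  Let \<open>P\<close>, \<open>Q\<close>, \<open>R\<close> be the Eisenstein series of weights 2, 4, 6 and \<open>\<theta> = q d/dq\<close>. Every convolution sum in
  the formula is a coefficient of a product of \<open>P(az)\<close>, \<open>P(bz)\<close>, \<open>Q(az)\<close> and their \<open>\<theta>\<close>-derivatives. By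
  Ramanujan's identities \<open>12 \<theta>P = P\<^sup>2 - Q\<close> and \<open>3 \<theta>Q = PQ - R\<close> the combination occurring in the formula is, up
  to a factor, \<open>-(A - B)\<^sup>3/12 + a\<^sup>2 Q(az)(B - A)/12 + b\<^sup>2 Q(bz)(A - B)/4 + (a\<^sup>3 R(az) + b\<^sup>3 R(bz))/6\<close> with
  \<open>A = a P(az)\<close> and \<open>B = b P(bz)\<close>. Since \<open>A - B\<close> is a modular form, this lies in \<open>M\<^sub>6(ab)\<close> and is a
  combination of the given basis.

  Here \<open>Q\<close> and \<open>R\<close> are defined by Ramanujan's identities, so that their modularity follows from that of \<open>P\<close>
  by differentiation. That \<open>Q\<close> has the coefficients \<open>240 \<divisor_sigma>\<^sub>3(n)\<close> is Besge's formula for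
  \<open>\<Sum> \<divisor_sigma>(i) \<divisor_sigma>(n - i)\<close>, which is elementary.
\<close>

subsection \<open>Besge's formula\<close>

text \<open>The constants are forced by the requirement that A and B enter only through A - B.
  Modulo Q and R, the terms with one derivative of a product, \<open>3 a b\<close> times the
  difference of \<theta>P(az) P(bz) and P(az) \<theta>P(bz), give (A^2 B - A B^2)/4; the term behind
  S gives -A^3/6; the second derivatives, weighted by \<open>6 a\<close> and \<open>6 b\<close>,
  give A^3/12 and B^3/12. Only together do these form a cube, which is why S(n/a) and the summands
  with n^2 must occur. The term behind the sum of \<sigma> and \<sigma>_3 raises the coefficient of
  B Q(az) from -1/4 to 1/12 (up to the factor a^2), the negative of that of A Q(az). Two obstacles
  shape the rest. The lattice series of weight 2 converges only conditionally, so that the law of P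
  under inversion needs an argument of its own. And membership in the space of modular forms asks
  for bounded translates under all of SL_2(Z), where f(az) turns into f at a point (a1 z + b1)/d1;
  the same computation then yields the invariance under the subgroup.\<close>

definition divisor_sigma :: "nat \<Rightarrow> nat \<Rightarrow> nat" where
  "divisor_sigma r n = (if n = 0 then 0 else \<Sum>d | d dvd n. d ^ r)"

lemma div_sigma_of_nat: "div_sigma r (real n) = divisor_sigma r n"
  by (simp add: div_sigma_def divisor_sigma_def)

lemma real_divide_in_Nats_iff:
  assumes "a > 0"
  shows "real n / real a \<in> \<nat> \<longleftrightarrow> a dvd n"
proof
  assume "real n / real a \<in> \<nat>"
  then obtain k where "real n / real a = real k" by (auto elim: Nats_cases)
  then have "real n = real (a * k)" using assms by (simp add: field_simps)
  then have "n = a * k" by (simp only: of_nat_eq_iff)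
  then show "a dvd n" by simp
qed (use assms in auto)

lemma div_sigma_div:
  assumes "a > 0"
  shows "div_sigma r (real n / real a) = (if a dvd n then divisor_sigma r (n div a) else 0)"
proof (cases "a dvd n")
  case True
  then obtain k where "n = a * k" ..
  with assms show ?thesis by (simp add: div_sigma_of_nat)
qed (simp add: div_sigma_def real_divide_in_Nats_iff[OF assms])

text \<open>A divisor \<open>a\<close> of \<open>i\<close> and a divisor \<open>b\<close> of
  \<open>n - i\<close> are kept together with their cofactors \<open>x\<close> and \<open>y\<close>.
  Storing the cofactors exposes the bilinear form \<open>a * x + b * y\<close>, whose symmetries are
  the substitutions of Liouville's method.\<close>

definition quads :: "nat \<Rightarrow> (nat \<times> nat \<times> nat \<times> nat) set" where
  "quads n = {(a, x, b, y). a > 0 \<and> x > 0 \<and> b > 0 \<and> y > 0 \<and> a * x + b * y = n}"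

lemma finite_quads [simp]: "finite (quads n)"
proof (rule finite_subset)
  show "quads n \<subseteq> {..n} \<times> {..n} \<times> {..n} \<times> {..n}"
  proof
    fix t assume "t \<in> quads n"
    then obtain a x b y where t: "t = (a, x, b, y)" "a > 0" "x > 0" "b > 0" "y > 0" "a * x + b * y = n"
      by (auto simp: quads_def)
    have "a \<le> a * x" "x \<le> a * x" "b \<le> b * y" "y \<le> b * y" using t by simp_all
    then have "a \<le> n" "x \<le> n" "b \<le> n" "y \<le> n" using t(6) by linarith+
    then show "t \<in> {..n} \<times> {..n} \<times> {..n} \<times> {..n}" using t by simp
  qed
qed simp

definition qsum :: "nat \<Rightarrow> (nat \<Rightarrow> nat \<Rightarrow> nat \<Rightarrow> nat \<Rightarrow> bool) \<Rightarrow> (nat \<Rightarrow> nat \<Rightarrow> int) \<Rightarrow> int" where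
  "qsum n P f = (\<Sum>(a, x, b, y) \<in> quads n. if P a x b y then f a b else 0)"

lemma qsum_filter:
  "qsum n P f = (\<Sum>(a, x, b, y) \<in> {(a, x, b, y). (a, x, b, y) \<in> quads n \<and> P a x b y}. f a b)"
  unfolding qsum_def
  by (rule sum.mono_neutral_cong_right) (auto split: if_splits)

lemma qsum_reindex:
  assumes "\<And>a x b y. (a, x, b, y) \<in> quads n \<Longrightarrow> P a x b y \<Longrightarrow>
             h (a, x, b, y) \<in> {(a, x, b, y). (a, x, b, y) \<in> quads n \<and> Q a x b y} \<and> h' (h (a, x, b, y)) = (a, x, b, y)
             \<and> (case h (a, x, b, y) of (a', x', b', y') \<Rightarrow> g a' b') = f a b"
  and "\<And>a x b y. (a, x, b, y) \<in> quads n \<Longrightarrow> Q a x b y \<Longrightarrow>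
             h' (a, x, b, y) \<in> {(a, x, b, y). (a, x, b, y) \<in> quads n \<and> P a x b y} \<and> h (h' (a, x, b, y)) = (a, x, b, y)"
  shows "qsum n P f = qsum n Q g"
  unfolding qsum_filter
  by (rule sum.reindex_bij_witness[of _ h' h]; clarify; (drule (1) assms)?; simp)

lemma qsum_split:
  fixes u v :: "nat \<Rightarrow> nat \<Rightarrow> nat \<Rightarrow> nat \<Rightarrow> nat"
  shows "qsum n (\<lambda>a x b y. True) f = qsum n (\<lambda>a x b y. u a x b y < v a x b y) f
     + qsum n (\<lambda>a x b y. u a x b y = v a x b y) f + qsum n (\<lambda>a x b y. v a x b y < u a x b y) f"
  unfolding qsum_def sum.distrib[symmetric] by (rule sum.cong) auto

lemma qsum_swap: "qsum n P f = qsum n (\<lambda>a x b y. P b y a x) (\<lambda>a b. f b a)"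
  by (rule qsum_reindex[where h = "\<lambda>(a, x, b, y). (b, y, a, x)" and h' = "\<lambda>(a, x, b, y). (b, y, a, x)"])
     (auto simp: quads_def add.commute)

text \<open>The substitution rests on \<open>a * x + b * y = (a + b) * x + b * (y - x)\<close>,
  which keeps all four entries positive exactly when \<open>x < y\<close>.\<close>

lemma qsum_shear:
  "qsum n (\<lambda>a x b y. x < y) (\<lambda>a b. f (a + b) b) = qsum n (\<lambda>a x b y. b < a) f"
proof (rule qsum_reindex[where h = "\<lambda>(a, x, b, y). (a + b, x, b, y - x)"
      and h' = "\<lambda>(a, x, b, y). (a - b, x, b, y + x)"], goal_cases)
  case (1 a x b y)
  then obtain k where "y = x + k" "k > 0" using less_imp_add_positive by blast
  with 1 show ?case by (auto simp: quads_def algebra_simps)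
next
  case (2 a x b y)
  then obtain k where "a = b + k" "k > 0" using less_imp_add_positive by blast
  with 2 show ?case by (auto simp: quads_def algebra_simps)
qed

text \<open>Here \<open>a * x + b * y = a * (x - y) + (a + b) * y\<close>. The first entry is
  unchanged, so a summand depending on \<open>a\<close> alone is preserved.\<close>

lemma qsum_shear_fst:
  "qsum n (\<lambda>a x b y. y < x) (\<lambda>a b. f a) = qsum n (\<lambda>a x b y. a < b) (\<lambda>a b. f a)"
proof (rule qsum_reindex[where h = "\<lambda>(a, x, b, y). (a, x - y, a + b, y)"
      and h' = "\<lambda>(a, x, b, y). (a, x + y, b - a, y)"], goal_cases)
  case (1 a x b y)
  then obtain k where "x = y + k" "k > 0" using less_imp_add_positive by blast
  with 1 show ?case by (auto simp: quads_def algebra_simps)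
next
  case (2 a x b y)
  then obtain k where "b = a + k" "k > 0" using less_imp_add_positive by blast
  with 2 show ?case by (auto simp: quads_def algebra_simps)
qed

lemma qsum_add: "qsum n P (\<lambda>a b. f a b + g a b) = qsum n P f + qsum n P g"
  by (simp add: qsum_filter sum.distrib case_prod_unfold)

lemma qsum_cmult: "qsum n P (\<lambda>a b. c * f a b) = c * qsum n P f"
  by (simp add: qsum_filter sum_distrib_left case_prod_unfold)

lemma qsum_cong: "(\<And>a x b y. P a x b y \<Longrightarrow> f a b = g a b) \<Longrightarrow> qsum n P f = qsum n P g"
  unfolding qsum_filter by (rule sum.cong) auto

text \<open>
  Liouville's method: \<open>4ab\<close> is the difference of \<open>(a + b)\<^sup>2\<close> and \<open>(a - b)\<^sup>2\<close>, and the two shears trade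
  sums over the regions \<open>x < y\<close> and \<open>b < a\<close> for each other, so that only diagonal terms survive.
\<close>

lemma qsum_product_identity:
  "4 * qsum n (\<lambda>a x b y. True) (\<lambda>a b. int a * int b) =
     2 * qsum n (\<lambda>a x b y. x = y) (\<lambda>a b. (int a)\<^sup>2) + qsum n (\<lambda>a x b y. x = y) (\<lambda>a b. (int a + int b)\<^sup>2)
     - 2 * qsum n (\<lambda>a x b y. a = b) (\<lambda>a b. (int a)\<^sup>2)"
proof -
  let ?T = "\<lambda>a x b y. True :: bool"
  have *: "qsum n ?T (\<lambda>a b. (int a + int b)\<^sup>2) =
      qsum n ?T (\<lambda>a b. (int a - int b)\<^sup>2) + 4 * qsum n ?T (\<lambda>a b. int a * int b)"
    by (subst qsum_cmult[symmetric], subst qsum_add[symmetric], rule qsum_cong)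
       (simp add: power2_eq_square algebra_simps)
  have m: "qsum n ?T (\<lambda>a b. (int a - int b)\<^sup>2) = 2 * qsum n (\<lambda>a x b y. x < y) (\<lambda>a b. (int a)\<^sup>2)"
  proof -
    have "qsum n (\<lambda>a x b y. a = b) (\<lambda>a b. (int a - int b)\<^sup>2) = 0"
      unfolding qsum_filter by (rule sum.neutral) auto
    moreover have "qsum n (\<lambda>a x b y. a < b) (\<lambda>a b. (int a - int b)\<^sup>2)
        = qsum n (\<lambda>a x b y. b < a) (\<lambda>a b. (int a - int b)\<^sup>2)"
      by (subst qsum_swap) (simp add: power2_commute)
    moreover have "qsum n (\<lambda>a x b y. b < a) (\<lambda>a b. (int a - int b)\<^sup>2) = qsum n (\<lambda>a x b y. x < y) (\<lambda>a b. (int a)\<^sup>2)"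
      by (subst qsum_shear[symmetric]) simp
    ultimately show ?thesis
      by (subst qsum_split[where u = "\<lambda>a x b y. a" and v = "\<lambda>a x b y. b"]) simp
  qed
  have p: "qsum n ?T (\<lambda>a b. (int a + int b)\<^sup>2) =
      2 * qsum n (\<lambda>a x b y. b < a) (\<lambda>a b. (int a)\<^sup>2) + qsum n (\<lambda>a x b y. x = y) (\<lambda>a b. (int a + int b)\<^sup>2)"
  proof -
    have "qsum n (\<lambda>a x b y. y < x) (\<lambda>a b. (int a + int b)\<^sup>2) = qsum n (\<lambda>a x b y. x < y) (\<lambda>a b. (int a + int b)\<^sup>2)"
      by (subst qsum_swap) (simp add: add.commute)
    moreover have "qsum n (\<lambda>a x b y. x < y) (\<lambda>a b. (int a + int b)\<^sup>2) = qsum n (\<lambda>a x b y. b < a) (\<lambda>a b. (int a)\<^sup>2)"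
      by (subst qsum_shear[symmetric]) simp
    ultimately show ?thesis
      by (subst qsum_split[where u = "\<lambda>a x b y. x" and v = "\<lambda>a x b y. y"]) simp
  qed
  \<comment> \<open>The full sum of the squares of \<open>a\<close> is split once by comparing
    \<open>x\<close> with \<open>y\<close> and once by comparing \<open>a\<close> with
    \<open>b\<close>. The regions \<open>y < x\<close> and \<open>a < b\<close> agree by the second
    shear, so the regions left over in \<open>m\<close> and \<open>p\<close> differ by diagonal
    terms only.\<close>
  have "qsum n (\<lambda>a x b y. x < y) (\<lambda>a b. (int a)\<^sup>2) + qsum n (\<lambda>a x b y. x = y) (\<lambda>a b. (int a)\<^sup>2) =
     qsum n (\<lambda>a x b y. a = b) (\<lambda>a b. (int a)\<^sup>2) + qsum n (\<lambda>a x b y. b < a) (\<lambda>a b. (int a)\<^sup>2)"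
    using qsum_split[of n "\<lambda>a b. (int a)\<^sup>2" "\<lambda>a x b y. x" "\<lambda>a x b y. y"]
      qsum_split[of n "\<lambda>a b. (int a)\<^sup>2" "\<lambda>a x b y. a" "\<lambda>a x b y. b"]
      qsum_shear_fst[of n "\<lambda>a. (int a)\<^sup>2"] by simp
  then show ?thesis using * m p by simp
qed

text \<open>On this diagonal \<open>(a + b) * x = n\<close>, so \<open>d = a + b\<close> is a
  divisor of \<open>n\<close>, its cofactor is \<open>x\<close>, and \<open>a\<close> is free below
  \<open>d\<close>.\<close>

lemma qsum_eq_snd:
  assumes "n > 0"
  shows "qsum n (\<lambda>a x b y. x = y) f = (\<Sum>d | d dvd n. \<Sum>a = 1..<d. f a (d - a))"
proof -
  have fin: "finite {d. d dvd n}" using assms by simp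
  have "(\<Sum>d | d dvd n. \<Sum>a = 1..<d. f a (d - a)) =
      (\<Sum>(d, a) \<in> Sigma {d. d dvd n} (\<lambda>d. {1..<d}). f a (d - a))"
    by (rule sum.Sigma) (use fin in auto)
  also have "\<dots> = qsum n (\<lambda>a x b y. x = y) f"
    unfolding qsum_filter
  proof (rule sum.reindex_bij_witness[of _ "\<lambda>(a, x, b, y). (a + b, a)"
        "\<lambda>(d, a). (a, n div d, d - a, n div d)"], goal_cases)
    case (1 t)
    then obtain d a where t: "t = (d, a)" "d dvd n" "1 \<le> a" "a < d" by auto
    then show ?case by simp
  next
    case (2 t)
    then obtain d a where t: "t = (d, a)" "d dvd n" "1 \<le> a" "a < d" by auto
    then obtain k where k: "n = d * k" by auto
    have "a * k + (d - a) * k = d * k" using t by (simp add: add_mult_distrib[symmetric])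
    then show ?case using t k assms by (auto simp: quads_def)
  next
    case (3 t)
    then obtain a x b where t: "t = (a, x, b, x)" "a > 0" "b > 0" "x > 0" "a * x + b * x = n"
      by (auto simp: quads_def)
    then have "n = (a + b) * x" by (simp add: algebra_simps)
    then show ?case using t by simp
  next
    case (4 t)
    then obtain a x b where t: "t = (a, x, b, x)" "a > 0" "b > 0" "x > 0" "a * x + b * x = n"
      by (auto simp: quads_def)
    then have "n = (a + b) * x" by (simp add: algebra_simps)
    then show ?case using t by simp
  qed auto
  finally show ?thesis ..
qed

text \<open>On this diagonal \<open>a * (x + y) = n\<close>, so \<open>a\<close> is a divisor and
  its cofactor splits into two positive parts in \<open>n div a - 1\<close> ways.\<close>

lemma qsum_eq_fst:
  assumes "n > 0"
  shows "qsum n (\<lambda>a x b y. a = b) (\<lambda>a b. f a) = (\<Sum>d | d dvd n. (int (n div d) - 1) * f d)"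
proof -
  have fin: "finite {d. d dvd n}" using assms by simp
  have "(\<Sum>d | d dvd n. (int (n div d) - 1) * f d) = (\<Sum>d | d dvd n. \<Sum>x = 1..<n div d. f d)"
  proof (rule sum.cong)
    fix d assume "d \<in> {d. d dvd n}"
    then have "n div d > 0" using assms by (auto simp: div_greater_zero_iff dvd_imp_le)
    then show "(int (n div d) - 1) * f d = (\<Sum>x = 1..<n div d. f d)" by (simp add: of_nat_diff)
  qed simp
  also have "\<dots> = (\<Sum>(d, x) \<in> Sigma {d. d dvd n} (\<lambda>d. {1..<n div d}). f d)"
    by (rule sum.Sigma) (use fin in auto)
  also have "\<dots> = qsum n (\<lambda>a x b y. a = b) (\<lambda>a b. f a)"
    unfolding qsum_filter
  proof (rule sum.reindex_bij_witness[of _ "\<lambda>(a, x, b, y). (a, x)"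
        "\<lambda>(d, x). (d, x, d, n div d - x)"], goal_cases)
    case (2 t)
    then obtain d a where t: "t = (d, a)" "d dvd n" "1 \<le> a" "a < n div d" by auto
    then obtain k where k: "n = d * k" by auto
    then have "d > 0" using assms by simp
    then have "a < k" using t k by simp
    then have "d * a + d * (k - a) = d * k" by (simp add: add_mult_distrib2[symmetric])
    then show ?case using t k assms by (auto simp: quads_def)
  next
    case (3 t)
    then obtain a x b y where t: "t = (a, x, a, y)" "a > 0" "x > 0" "y > 0" "a * x + a * y = n"
      by (auto simp: quads_def)
    then have "n = a * (x + y)" by (simp add: algebra_simps)
    then show ?case using t by simp
  next
    case (4 t)
    then obtain a x b y where t: "t = (a, x, a, y)" "a > 0" "x > 0" "y > 0" "a * x + a * y = n"
      by (auto simp: quads_def)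
    then have "n = a * (x + y)" by (simp add: algebra_simps)
    then show ?case using t by simp
  qed auto
  finally show ?thesis ..
qed

lemma sum_squares_less: "6 * (\<Sum>a = 1..<d. (int a)\<^sup>2) = 2 * int d ^ 3 - 3 * int d ^ 2 + int d"
proof (induction d)
  case (Suc d)
  show ?case
  proof (cases "d = 0")
    case False
    then have "(\<Sum>a = 1..<Suc d. (int a)\<^sup>2) = (\<Sum>a = 1..<d. (int a)\<^sup>2) + (int d)\<^sup>2" by simp
    then show ?thesis using Suc by (simp add: algebra_simps power2_eq_square power3_eq_cube)
  qed simp
qed simp

lemma sum_sigma_eq_qsum:
  "(\<Sum>i\<le>n. int (divisor_sigma 1 i * divisor_sigma 1 (n - i))) = qsum n (\<lambda>a x b y. True) (\<lambda>a b. int a * int b)"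
proof -
  have "(\<Sum>i\<le>n. int (divisor_sigma 1 i * divisor_sigma 1 (n - i))) = (\<Sum>i \<in> {1..<n}. int (divisor_sigma 1 i * divisor_sigma 1 (n - i)))"
    by (rule sum.mono_neutral_right) (auto simp: divisor_sigma_def not_less_eq_eq)
  also have "\<dots> = (\<Sum>i \<in> {1..<n}. \<Sum>(a, b) \<in> {d. d dvd i} \<times> {d. d dvd n - i}. int a * int b)"
  proof (rule sum.cong)
    fix i assume "i \<in> {1..<n}"
    then have "i > 0" "n - i > 0" by auto
    then have "int (divisor_sigma 1 i * divisor_sigma 1 (n - i)) = (\<Sum>a | a dvd i. int a) * (\<Sum>b | b dvd n - i. int b)"
      by (simp add: divisor_sigma_def)
    also have "\<dots> = (\<Sum>(a, b) \<in> {d. d dvd i} \<times> {d. d dvd n - i}. int a * int b)"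
      by (simp add: sum_product sum.cartesian_product del: of_nat_sum)
    finally show "int (divisor_sigma 1 i * divisor_sigma 1 (n - i)) = (\<Sum>(a, b) \<in> {d. d dvd i} \<times> {d. d dvd n - i}. int a * int b)" .
  qed simp
  also have "\<dots> = (\<Sum>(i, t) \<in> Sigma {1..<n} (\<lambda>i. {d. d dvd i} \<times> {d. d dvd n - i}). case t of (a, b) \<Rightarrow> int a * int b)"
    by (rule sum.Sigma) auto
  also have "\<dots> = qsum n (\<lambda>a x b y. True) (\<lambda>a b. int a * int b)"
    unfolding qsum_filter
  proof (rule sum.reindex_bij_witness[of _ "\<lambda>(a, x, b, y). (a * x, a, b)"
        "\<lambda>(i, a, b). (a, i div a, b, (n - i) div b)"], goal_cases)
    case (2 t)
    then obtain i c d where t: "t = (i, c, d)" "c dvd i" "d dvd n - i" "0 < i" "i < n"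
      by (auto simp: Suc_le_eq)
    then obtain j k where "i = c * j" "n - i = d * k" by (auto elim!: dvdE)
    moreover from this have "0 < c * j" "0 < d * k" using t by linarith+
    ultimately show ?case using t by (auto simp: quads_def)
  next
    case (4 t)
    then show ?case by (auto simp: quads_def)
  qed (auto simp: quads_def)
  finally show ?thesis .
qed

text \<open>All three diagonal sums of the product identity are divisor power sums. Each contains
  the sum of the squares of the divisors, with total coefficient -1 - 1 + 2 = 0, and the cubes
  collect to 2/3 + 1 = 5/3.\<close>

theorem besge:
  "12 * (\<Sum>i\<le>n. int (divisor_sigma 1 i * divisor_sigma 1 (n - i))) =
     5 * int (divisor_sigma 3 n) - (6 * int n - 1) * int (divisor_sigma 1 n)"
proof (cases "n = 0")
  case False
  then have n: "n > 0" by simp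
  let ?s = "\<lambda>k. \<Sum>d | d dvd n. int d ^ k"
  have s: "int (divisor_sigma k n) = ?s k" for k using n by (simp add: divisor_sigma_def)
  have 1: "6 * qsum n (\<lambda>a x b y. x = y) (\<lambda>a b. (int a)\<^sup>2) = 2 * ?s 3 - 3 * ?s 2 + ?s 1"
    unfolding qsum_eq_snd[OF n]
    by (subst sum_distrib_left, simp only: sum_squares_less) 
       (simp add: sum_distrib_left sum_subtractf sum.distrib)
  have 2: "qsum n (\<lambda>a x b y. x = y) (\<lambda>a b. (int a + int b)\<^sup>2) = ?s 3 - ?s 2"
    unfolding qsum_eq_snd[OF n] sum_subtractf[symmetric]
  proof (rule sum.cong)
    fix d assume "d \<in> {d. d dvd n}"
    then have "d > 0" using n by (auto dest: dvd_pos_nat)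
    moreover have "(\<Sum>a = 1..<d. (int a + int (d - a))\<^sup>2) = (\<Sum>a = 1..<d. (int d)\<^sup>2)"
      by (rule sum.cong) (auto simp: of_nat_diff)
    ultimately show "(\<Sum>a = 1..<d. (int a + int (d - a))\<^sup>2) = int d ^ 3 - int d ^ 2"
      by (simp add: of_nat_diff algebra_simps power2_eq_square power3_eq_cube)
  qed simp
  have 3: "qsum n (\<lambda>a x b y. a = b) (\<lambda>a b. (int a)\<^sup>2) = int n * ?s 1 - ?s 2"
    unfolding qsum_eq_fst[OF n] sum_subtractf[symmetric] sum_distrib_left
    by (rule sum.cong) (use n in \<open>auto elim!: dvdE simp: algebra_simps power2_eq_square\<close>)
  show ?thesis
    unfolding sum_sigma_eq_qsum s using qsum_product_identity[of n] 1 2 3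
    by (simp add: algebra_simps)
qed (simp add: divisor_sigma_def)

subsection \<open>Partial fractions of the cotangent\<close>

text \<open>This is the logarithmic derivative of Euler's reflection formula: both sides of
  \<open>Gamma z * Gamma (1 - z) = pi / sin (pi * z)\<close> are differentiated and
  compared.\<close>

lemma Digamma_reflection:
  fixes w :: complex
  assumes "w \<notin> \<int>"
  shows "Digamma (1 - w) - Digamma w = of_real pi * cot (of_real pi * w)"
proof -
  have w1: "1 - w \<notin> \<int>" using assms by (metis Ints_1 Ints_diff add_diff_cancel_left' diff_add_cancel)
  have ni: "w \<notin> \<int>\<^sub>\<le>\<^sub>0" "1 - w \<notin> \<int>\<^sub>\<le>\<^sub>0" using assms w1 by (auto dest: nonpos_Ints_Int)
  have s: "sin (of_real pi * w) \<noteq> 0"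
    using assms by (metis mult.commute sin_eq_0 of_real_eq_0_iff pi_neq_zero Ints_of_int mult_cancel_left2 mult_right_cancel of_real_mult of_real_of_int_eq)
  have 1: "((\<lambda>z. Gamma z * Gamma (1 - z)) has_field_derivative
      Gamma w * Gamma (1 - w) * (Digamma w - Digamma (1 - w))) (at w)"
    by (rule derivative_eq_intros refl ni | simp add: ni algebra_simps)+
  have 2: "((\<lambda>z. Gamma z * Gamma (1 - z)) has_field_derivative
     - (of_real pi * (of_real pi * cos (of_real pi * w))) / (sin (of_real pi * w))\<^sup>2) (at w)"
    unfolding Gamma_reflection_complex
    by (rule derivative_eq_intros refl s | simp add: s power2_eq_square)+
  have eq: "Gamma w * Gamma (1 - w) * (Digamma w - Digamma (1 - w)) =
     - (of_real pi * (of_real pi * cos (of_real pi * w))) / (sin (of_real pi * w))\<^sup>2"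
    using DERIV_unique[OF 1 2] .
  have "S * D = - (p * C)"
    if "p / S * D = - (p * (p * C)) / S\<^sup>2" "S \<noteq> 0" "p \<noteq> 0" for S D p C :: complex
  proof -
    have "S * D = (p / S * D) * (S * S / p)" using that(2,3) by simp
    also have "\<dots> = - (p * C)" unfolding that(1) using that(2,3) by (simp add: power2_eq_square)
    finally show ?thesis .
  qed
  from this[OF eq[unfolded Gamma_reflection_complex] s]
  have "sin (of_real pi * w) * (Digamma w - Digamma (1 - w)) = - (of_real pi * cos (of_real pi * w))"
    by simp
  moreover have "E - D = p * (C / S)" if "S * (D - E) = - (p * C)" "S \<noteq> 0" for S D E p C :: complex
    using that by (simp add: field_simps)
  ultimately show ?thesis unfolding cot_def using s by blast
qed

text \<open>The reflection formula for \<open>Digamma\<close> holds on the open set of non-integers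
  and may therefore be differentiated once more there.\<close>

lemma Polygamma_1_reflection:
  fixes w :: complex
  assumes "w \<notin> \<int>"
  shows "Polygamma 1 (1 - w) + Polygamma 1 w = (of_real pi / sin (of_real pi * w))\<^sup>2"
proof -
  have w1: "1 - w \<notin> \<int>" using assms by (metis Ints_1 Ints_diff add_diff_cancel_left' diff_add_cancel)
  have ni: "w \<notin> \<int>\<^sub>\<le>\<^sub>0" "1 - w \<notin> \<int>\<^sub>\<le>\<^sub>0" using assms w1 by (auto dest: nonpos_Ints_Int)
  have s: "sin (of_real pi * w) \<noteq> 0"
    using assms by (metis mult.commute sin_eq_0 of_real_eq_0_iff pi_neq_zero Ints_of_int mult_cancel_left2 mult_right_cancel of_real_mult of_real_of_int_eq)
  have op: "open (- \<int> :: complex set)" by (simp add: closed_Ints open_Compl)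
  have 1: "((\<lambda>z. Digamma (1 - z) - Digamma z) has_field_derivative
      - Polygamma 1 (1 - w) - Polygamma 1 w) (at w)"
    by (rule derivative_eq_intros refl ni | simp add: ni algebra_simps)+
  have 2: "((\<lambda>z. of_real pi * cot (of_real pi * z)) has_field_derivative
      - (of_real pi / sin (of_real pi * w))\<^sup>2) (at w)"
  proof -
    have *: "((\<lambda>z. of_real pi * cot (of_real pi * z)) has_field_derivative
      of_real pi * (((- sin (of_real pi * w) * of_real pi) * sin (of_real pi * w)
        - cos (of_real pi * w) * (cos (of_real pi * w) * of_real pi)) / (sin (of_real pi * w) * sin (of_real pi * w)))) (at w)"
      unfolding cot_def
      by (rule derivative_eq_intros refl s | simp add: s)+
    have "p * (((- S * p) * S - C * (C * p)) / (S * S)) = - (p / S)\<^sup>2"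
      if "S\<^sup>2 + C\<^sup>2 = 1" "S \<noteq> 0" for S C p :: complex
    proof -
      have "(- S * p) * S - C * (C * p) = - p * (S\<^sup>2 + C\<^sup>2)"
        by (simp add: algebra_simps power2_eq_square)
      also have "\<dots> = - p" unfolding that(1) by simp
      finally show ?thesis by (simp only:) (simp add: power2_eq_square)
    qed
    from this[OF sin_cos_squared_add s] show ?thesis using * by (simp only:)
  qed
  have "((\<lambda>z. of_real pi * cot (of_real pi * z)) has_field_derivative
      - Polygamma 1 (1 - w) - Polygamma 1 w) (at w)"
    by (rule has_field_derivative_transform_within_open[OF 1 op])
       (use assms Digamma_reflection in auto)
  from DERIV_unique[OF this 2] show ?thesis by (metis add_diff_cancel_left' diff_add_cancel minus_diff_eq neg_equal_iff_equal uminus_add_conv_diff add_uminus_conv_diff minus_add_distrib)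
qed

lemma cot_partial_fractions:
  fixes w :: complex
  assumes "w \<notin> \<int>"
  shows "(\<lambda>n. 1 / (w + of_nat (Suc n)) + 1 / (w - of_nat (Suc n))) sums (of_real pi * cot (of_real pi * w) - 1 / w)"
proof -
  have nz: "w \<noteq> 0" "1 - w \<noteq> 0" using assms by auto
  have a: "(\<lambda>k. inverse (of_nat (Suc k)) - inverse (w + of_nat k)) sums (Digamma w + euler_mascheroni)"
    using summable_Digamma[OF nz(1)] by (simp add: Digamma_def summable_sums)
  have b: "(\<lambda>k. inverse (of_nat (Suc k)) - inverse (1 - w + of_nat k)) sums (Digamma (1 - w) + euler_mascheroni)"
    using summable_Digamma[OF nz(2)] by (simp add: Digamma_def summable_sums)
  \<comment> \<open>The series for \<open>Digamma w\<close> starts with the pole at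
    \<open>w + 0\<close>. Adding a telescoping series moves the start to \<open>w + 1\<close> and
    produces the summand \<open>- 1 / w\<close> of the limit.\<close>
  have t: "(\<lambda>n. inverse (w + of_nat (Suc n)) - inverse (w + of_nat n)) sums (0 - inverse (w + of_nat 0))"
    by (intro telescope_sums filterlim_compose[OF tendsto_inverse_0]
              tendsto_add_filterlim_at_infinity[OF tendsto_const] tendsto_of_nat)
  have eq: "- inverse (1 - w + of_nat n) = 1 / (w - of_nat (Suc n))" for n
    by (subst inverse_minus_eq[symmetric]) (simp add: inverse_eq_divide algebra_simps)
  have "(\<lambda>k. (inverse (w + of_nat (Suc k)) - inverse (w + of_nat k)) +
      ((inverse (of_nat (Suc k)) - inverse (1 - w + of_nat k)) - (inverse (of_nat (Suc k)) - inverse (w + of_nat k))))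
     sums ((0 - inverse (w + of_nat 0)) + ((Digamma (1 - w) + euler_mascheroni) - (Digamma w + euler_mascheroni)))"
    by (rule sums_add[OF t sums_diff[OF b a]])
  also have "(\<lambda>k. (inverse (w + of_nat (Suc k)) - inverse (w + of_nat k)) +
      ((inverse (of_nat (Suc k)) - inverse (1 - w + of_nat k)) - (inverse (of_nat (Suc k)) - inverse (w + of_nat k))))
      = (\<lambda>n. 1 / (w + of_nat (Suc n)) + 1 / (w - of_nat (Suc n)))"
    unfolding eq[symmetric] by (simp add: inverse_eq_divide)
  finally show ?thesis using Digamma_reflection[OF assms] by (simp add: inverse_eq_divide)
qed

lemma inverse_sin_squared_partial_fractions:
  fixes w :: complex
  assumes "w \<notin> \<int>"
  shows "(\<lambda>n. 1 / (w + of_nat (Suc n))\<^sup>2 + 1 / (w - of_nat (Suc n))\<^sup>2) sums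
     ((of_real pi / sin (of_real pi * w))\<^sup>2 - 1 / w\<^sup>2)"
proof -
  have nz: "w \<noteq> 0" "1 - w \<noteq> 0" using assms by auto
  have a: "(\<lambda>k. inverse ((w + of_nat k)\<^sup>2)) sums Polygamma 1 w"
    using Polygamma_converges'[OF nz(1), of 2] by (simp add: Polygamma_def summable_sums power2_eq_square)
  have b: "(\<lambda>k. inverse ((1 - w + of_nat k)\<^sup>2)) sums Polygamma 1 (1 - w)"
    using Polygamma_converges'[OF nz(2), of 2] by (simp add: Polygamma_def summable_sums power2_eq_square)
  have eq: "inverse ((1 - w + of_nat n)\<^sup>2) = 1 / (w - of_nat (Suc n))\<^sup>2" for n
    by (subst power2_minus[symmetric]) (simp add: inverse_eq_divide algebra_simps)
  have a': "(\<lambda>k. inverse ((w + of_nat (Suc k))\<^sup>2)) sums (Polygamma 1 w - 1 / w\<^sup>2)"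
    using sums_split_initial_segment[OF a, of 1] by (simp add: inverse_eq_divide)
  have "(\<lambda>n. 1 / (w + of_nat (Suc n))\<^sup>2 + 1 / (w - of_nat (Suc n))\<^sup>2) sums
      ((Polygamma 1 w - 1 / w\<^sup>2) + Polygamma 1 (1 - w))"
    using sums_add[OF a' b[unfolded eq]] by (simp only: inverse_eq_divide)
  then show ?thesis using Polygamma_1_reflection[OF assms] by (simp add: algebra_simps)
qed

section \<open>The variable q and the cotangent in terms of it\<close>

definition qpar :: "complex \<Rightarrow> complex" where
  "qpar z = exp (2 * of_real pi * \<i> * z)"

lemma norm_qpar: "norm (qpar z) = exp (- 2 * pi * Im z)"
  by (simp add: qpar_def)

lemma norm_qpar_less_1: "Im z > 0 \<Longrightarrow> norm (qpar z) < 1"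
  by (simp add: norm_qpar)

lemma qpar_nonzero [simp]: "qpar z \<noteq> 0"
  by (simp add: qpar_def)

lemma not_Ints_Im: "Im w \<noteq> 0 \<Longrightarrow> w \<notin> \<int>"
  by (auto elim!: Ints_cases)

text \<open>Lipschitz's formula in weight 2. The sine is \<open>(E - 1 / E) / (2 * \<i>)\<close>
  with \<open>E * E = qpar w\<close>; squaring \<open>2 * \<i>\<close> accounts for the factor
  -4.\<close>

lemma inverse_square_sums_qpar:
  fixes w :: complex
  assumes "Im w > 0"
  shows "(\<lambda>n. 1 / (w + of_nat (Suc n))\<^sup>2 + 1 / (w - of_nat (Suc n))\<^sup>2) sums
     (- 4 * of_real pi ^ 2 * (qpar w / (1 - qpar w)\<^sup>2) - 1 / w\<^sup>2)"
proof -
  let ?e = "exp (\<i> * (of_real pi * w))"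
  have q: "qpar w = ?e * ?e"
    by (simp add: qpar_def exp_add[symmetric] algebra_simps)
  have ne: "qpar w \<noteq> 1" using norm_qpar_less_1[OF assms] by auto
  have sin: "sin (of_real pi * w) = (?e - 1 / ?e) / (2 * \<i>)"
    by (simp add: sin_exp_eq exp_minus inverse_eq_divide)
  have "(p / ((E - 1 / E) / (2 * \<i>)))\<^sup>2 = - 4 * p ^ 2 * (E * E / (1 - E * E)\<^sup>2)"
    if E: "E \<noteq> 0" "E * E \<noteq> 1" for E p :: complex
  proof -
    define K where "K = 1 - E * E"
    have K: "K \<noteq> 0" "E - 1 / E = - (K / E)" using E by (simp_all add: K_def field_simps)
    have "(p / ((E - 1 / E) / (2 * \<i>)))\<^sup>2 = p\<^sup>2 / ((K\<^sup>2 / E\<^sup>2) / - 4)"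
      unfolding K by (simp add: power_divide power_mult_distrib)
    then show ?thesis
      unfolding K_def[symmetric] using K(1) E(1) by (simp add: power2_eq_square)
  qed
  from this[of ?e] ne have "(of_real pi / sin (of_real pi * w))\<^sup>2 = - 4 * of_real pi ^ 2 * (qpar w / (1 - qpar w)\<^sup>2)"
    unfolding q sin by simp
  then show ?thesis
    using inverse_sin_squared_partial_fractions[OF not_Ints_Im, of w] assms by simp
qed

text \<open>The imaginary part of the argument tends to minus infinity, where the cotangent tends to
  \<i>. The quantity \<open>r N\<close> is the exponential that decays in this direction. This
  nonzero limit is the source of the anomaly of \<open>E2\<close>.\<close>

lemma cot_limit_lower:
  assumes "Im w < 0"
  shows "(\<lambda>N. cot (of_real pi * (of_nat N + 1 / 2) * w)) \<longlonglongrightarrow> \<i>"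
proof -
  define r where "r N = exp (2 * \<i> * (of_real pi * (of_nat N + 1 / 2) * - w))" for N :: nat
  have nr: "norm (r N) = exp (pi * (2 * real N + 1) * Im w)" for N
    by (simp add: r_def algebra_simps)
  have r0: "r \<longlonglongrightarrow> 0"
  proof (rule tendsto_norm_zero_cancel, unfold nr)
    show "(\<lambda>N. exp (pi * (2 * real N + 1) * Im w)) \<longlonglongrightarrow> 0"
    proof -
      have "(\<lambda>N. exp (pi * Im w) * exp (2 * pi * Im w) ^ N) \<longlonglongrightarrow> exp (pi * Im w) * 0"
        using assms by (intro tendsto_mult_left LIMSEQ_realpow_zero) (auto simp: mult_pos_neg)
      moreover have "exp (pi * Im w) * exp (2 * pi * Im w) ^ N = exp (pi * (2 * real N + 1) * Im w)" for N
        by (simp add: exp_of_nat_mult[symmetric] exp_add[symmetric] algebra_simps)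
      ultimately show ?thesis by (simp only: mult_zero_right)
    qed
  qed
  have "cot (of_real pi * (of_nat N + 1 / 2) * w) = \<i> * (1 + r N) / (1 - r N)" for N
  proof -
    let ?t = "of_real pi * (of_nat N + 1 / 2) * w"
    let ?e = "exp (\<i> * ?t)"
    have "2 * \<i> * (of_real pi * (of_nat N + 1 / 2) * - w) = - (\<i> * ?t + \<i> * ?t)"
      by (simp add: algebra_simps)
    then have r: "r N = 1 / (?e * ?e)"
      unfolding r_def by (simp only: exp_minus exp_add inverse_eq_divide)
    have cot: "cot ?t = ((?e + 1 / ?e) / 2) / ((?e - 1 / ?e) / (2 * \<i>))"
      by (simp only: cot_def sin_exp_eq cos_exp_eq exp_minus inverse_eq_divide)
    have "((E + 1 / E) / 2) / ((E - 1 / E) / (2 * \<i>)) = \<i> * (1 + 1 / (E * E)) / (1 - 1 / (E * E))"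
      if "E \<noteq> 0" for E :: complex
    proof -
      have "E + 1 / E = E * (1 + 1 / (E * E))" "E - 1 / E = E * (1 - 1 / (E * E))"
        using that by (simp_all add: field_simps)
      moreover have "((E * M) / 2) / ((E * K) / (2 * \<i>)) = \<i> * M / K" for M K
        using that by (cases "K = 0") (simp_all add: divide_simps)
      ultimately show ?thesis by (simp only:)
    qed
    from this[of ?e] have "((?e + 1 / ?e) / 2) / ((?e - 1 / ?e) / (2 * \<i>)) = \<i> * (1 + r N) / (1 - r N)"
      unfolding r by (simp only: exp_not_eq_zero not_False_eq_True)
    with cot show ?thesis by (simp only:)
  qed
  moreover have "(\<lambda>N. \<i> * (1 + r N) / (1 - r N)) \<longlonglongrightarrow> \<i> * (1 + 0) / (1 - 0)"
    by (intro tendsto_intros r0) simp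
  ultimately show ?thesis by simp
qed

subsection \<open>The Eisenstein series of weight 2\<close>

lemma has_sum_of_nat_mult_power:
  fixes x :: "'a :: {real_normed_field, banach}"
  assumes "norm x < 1"
  shows "((\<lambda>d. of_nat d * x ^ d) has_sum (x / (1 - x)\<^sup>2)) UNIV"
proof -
  have *: "(\<lambda>d. of_nat d * y ^ d) sums (y / (1 - y)\<^sup>2)" if "norm y < 1"
    for y :: "'b :: {real_normed_field, banach}"
  proof -
    have "(\<lambda>n. y * (of_nat (Suc n) * y ^ n)) sums (y * (1 / (1 - y)\<^sup>2))"
      by (intro sums_mult geometric_deriv_sums that)
    then have "(\<lambda>n. of_nat (Suc n) * y ^ Suc n) sums (y / (1 - y)\<^sup>2)" by (simp add: algebra_simps)
    from sums_Suc[OF this] show ?thesis by simp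
  qed
  show ?thesis
  proof (rule norm_summable_imp_has_sum[OF _ *[OF assms]])
    show "summable (\<lambda>n. norm (of_nat n * x ^ n))"
      using *[of "norm x"] assms by (simp add: norm_mult norm_power sums_iff)
  qed
qed

text \<open>Both series are groupings of the absolutely convergent double series of
  \<open>d * q ^ (m * d)\<close> with \<open>m = Suc i\<close>: summing over \<open>d\<close> first
  gives the Lambert form, collecting the terms with \<open>m * d = n\<close> gives the divisor
  sums.\<close>

lemma lambert_sigma:
  fixes q :: complex
  assumes "norm q < 1"
  obtains L where "(\<lambda>n. of_nat (divisor_sigma 1 n) * q ^ n) sums L"
    and "(\<lambda>m. q ^ Suc m / (1 - q ^ Suc m)\<^sup>2) sums L"
proof -
  define r where "r = norm q"
  have r: "0 \<le> r" "r < 1" using assms by (auto simp: r_def)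
  define f :: "nat \<times> nat \<Rightarrow> complex" where "f = (\<lambda>(i, d). of_nat d * (q ^ Suc i) ^ d)"
  have lt: "norm (q ^ Suc i) < 1" for i
    using assms by (simp add: norm_power power_less_one_iff del: power_Suc)
  have "summable (\<lambda>i. r ^ Suc i / (1 - r ^ Suc i)\<^sup>2)"
  proof (rule summable_comparison_test')
    show "summable (\<lambda>i. r ^ Suc i * (1 / (1 - r)\<^sup>2))"
      using r by (intro summable_mult2) (simp add: summable_Suc_iff summable_geometric del: power_Suc)
    fix i :: nat
    have "r ^ Suc i \<le> r" using r by (simp add: mult_left_le power_le_one)
    then have "(1 - r)\<^sup>2 \<le> (1 - r ^ Suc i)\<^sup>2" using r by (intro power_mono) auto
    then show "norm (r ^ Suc i / (1 - r ^ Suc i)\<^sup>2) \<le> r ^ Suc i * (1 / (1 - r)\<^sup>2)"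
      using r by (simp add: divide_simps mult_left_mono frac_le del: power_Suc)
  qed
  then have g: "(\<lambda>i. r ^ Suc i / (1 - r ^ Suc i)\<^sup>2) summable_on UNIV"
    using r by (intro summable_nonneg_imp_summable_on) auto
  have "(\<lambda>x. norm (f x)) summable_on UNIV \<times> UNIV"
  proof (rule summable_on_SigmaI[OF _ g])
    show "((\<lambda>y. norm (f (i, y))) has_sum r ^ Suc i / (1 - r ^ Suc i)\<^sup>2) UNIV" for i
      using has_sum_of_nat_mult_power[of "r ^ Suc i"] lt[of i]
      by (simp add: f_def norm_mult norm_power r_def del: power_Suc)
  qed auto
  then have "f summable_on UNIV \<times> UNIV" by (rule abs_summable_summable)
  then obtain L where L: "(f has_sum L) (UNIV \<times> UNIV)" using has_sum_infsum by blast
  have "((\<lambda>i. q ^ Suc i / (1 - q ^ Suc i)\<^sup>2) has_sum L) UNIV"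
    by (rule has_sum_Sigma'[OF L]) (use has_sum_of_nat_mult_power[OF lt] in \<open>simp add: f_def del: power_Suc\<close>)
  then have 1: "(\<lambda>m. q ^ Suc m / (1 - q ^ Suc m)\<^sup>2) sums L" by (rule has_sum_imp_sums)
  \<comment> \<open>The terms with \<open>d = 0\<close> vanish and are dropped, because the map to
    \<open>(Suc i * d, d)\<close> is a bijection onto pairs of a positive number and a divisor only
    for positive \<open>d\<close>.\<close>
  have "(f has_sum L) (UNIV \<times> {1..})"
    by (subst has_sum_cong_neutral[where T = "UNIV \<times> UNIV" and g = f]) 
       (use L in \<open>auto simp: f_def not_less_eq_eq\<close>)
  also have "?this \<longleftrightarrow> ((\<lambda>(n, d). of_nat d * q ^ n) has_sum L) (Sigma {1..} (\<lambda>n. {d. d dvd n}))"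
  proof (rule has_sum_reindex_bij_witness[where j = "\<lambda>(i, d). (Suc i * d, d)" and i = "\<lambda>(n, d). (n div d - 1, d)"], goal_cases)
    case (3 t)
    then obtain n d where t: "t = (n, d)" "d dvd n" "n > 0" by (auto simp: Suc_le_eq)
    then have "n div d > 0" by (auto simp: div_greater_zero_iff dvd_imp_le intro: Nat.gr0I)
    then have "Suc (n div d - 1) = n div d" by simp
    then show ?case unfolding t using t(2) by (simp only: split dvd_div_mult_self)
  next
    case (5 t)
    then show ?case by (auto simp: f_def power_mult[symmetric] simp del: power_Suc)
  qed (auto simp: Suc_le_eq intro: Nat.gr0I)
  finally have "((\<lambda>n. of_nat (divisor_sigma 1 n) * q ^ n) has_sum L) {1..}"
    by (rule has_sum_Sigma') (auto intro!: has_sum_finiteI simp: divisor_sigma_def sum_distrib_right)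
  then have "((\<lambda>n. of_nat (divisor_sigma 1 n) * q ^ n) has_sum L) UNIV"
    by (subst has_sum_cong_neutral[where T = "{1..}"]) (auto simp: divisor_sigma_def not_less_eq_eq)
  then have "(\<lambda>n. of_nat (divisor_sigma 1 n) * q ^ n) sums L" by (rule has_sum_imp_sums)
  with 1 show ?thesis using that by blast
qed

lemma lattice_lower_bound:
  assumes "Im z > 0"
  obtains c where "c > 0" "\<And>m n :: real. c * \<bar>m\<bar> \<le> norm (of_real m * z + of_real n)"
    "\<And>m n :: real. c * \<bar>n\<bar> \<le> norm (of_real m * z + of_real n)"
proof -
  define y where "y = Im z"
  define c where "c = min y (y / (y + norm z))"
  have y: "y > 0" and yz: "y + norm z > 0" using assms by (auto simp: y_def add_pos_nonneg)
  have c: "c > 0" using y yz by (simp add: c_def)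
  have 1: "y * \<bar>m\<bar> \<le> norm (of_real m * z + of_real n)" for m n :: real
    using abs_Im_le_cmod[of "of_real m * z + of_real n"] y by (simp add: abs_mult y_def mult.commute)
  have 2: "(y / (y + norm z)) * \<bar>n\<bar> \<le> norm (of_real m * z + of_real n)" for m n :: real
  proof -
    let ?N = "norm (of_real m * z + of_real n)"
    have "\<bar>n\<bar> = norm ((of_real m * z + of_real n) - of_real m * z)" by simp
    also have "\<dots> \<le> ?N + norm (of_real m * z)" by (rule norm_triangle_ineq4)
    finally have "\<bar>n\<bar> \<le> ?N + \<bar>m\<bar> * norm z" by (simp add: norm_mult)
    from mult_left_mono[OF this, of y] y
    have "y * \<bar>n\<bar> \<le> y * ?N + (y * \<bar>m\<bar>) * norm z" by (simp add: distrib_left mult.assoc)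
    also have "\<dots> \<le> y * ?N + ?N * norm z" by (intro add_left_mono mult_right_mono 1) simp
    finally have "y * \<bar>n\<bar> \<le> ?N * (y + norm z)" by (simp add: algebra_simps)
    then show ?thesis using yz by (simp add: pos_divide_le_eq)
  qed
  show ?thesis
  proof (rule that[OF c])
    fix m n :: real
    have "c * \<bar>m\<bar> \<le> y * \<bar>m\<bar>" by (intro mult_right_mono) (simp_all add: c_def)
    then show "c * \<bar>m\<bar> \<le> norm (of_real m * z + of_real n)" using 1[of m n] by linarith
    have "c * \<bar>n\<bar> \<le> (y / (y + norm z)) * \<bar>n\<bar>" by (intro mult_right_mono) (simp_all add: c_def)
    then show "c * \<bar>n\<bar> \<le> norm (of_real m * z + of_real n)" using 2[of n m] by linarith
  qed
qed

text \<open>The bound is a product of two summable sequences, so the family is absolutely summable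
  on pairs and both iterated sums equal its unconditional sum.\<close>

lemma sums_swap:
  fixes e :: "nat \<Rightarrow> nat \<Rightarrow> complex"
  assumes bound: "\<And>i j. norm (e i j) \<le> C * (1 / (real (Suc i))\<^sup>2) * (1 / (real (Suc j))\<^sup>2)"
  obtains E where "(\<lambda>i. \<Sum>j. e i j) sums E" "(\<lambda>j. \<Sum>i. e i j) sums E"
    "\<And>i. summable (\<lambda>j. e i j)" "\<And>j. summable (\<lambda>i. e i j)"
proof -
  define s where "s i = 1 / (real (Suc i))\<^sup>2" for i
  have bound': "norm (e i j) \<le> C * s i * s j" for i j unfolding s_def by (rule bound)
  have s: "summable s" using inverse_squares_sums by (simp add: s_def[abs_def] sums_iff add.commute)
  have s_nonneg: "s i \<ge> 0" for i by (simp add: s_def)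
  have sp: "s summable_on UNIV" by (intro summable_nonneg_imp_summable_on s s_nonneg)
  have "((\<lambda>j. s j) has_sum infsum s UNIV) UNIV" using sp by simp
  then have in1: "((\<lambda>j. (C * s i) * s j) has_sum (C * s i) * infsum s UNIV) UNIV" for i
    by (rule has_sum_cmult_right)
  have C: "C \<ge> 0" using order_trans[OF norm_ge_zero bound[of 0 0]] by simp
  have "(\<lambda>(i, j). C * s i * s j) summable_on UNIV \<times> UNIV"
  proof (rule summable_on_SigmaI)
    show "((\<lambda>j. case (i, j) of (i, j) \<Rightarrow> C * s i * s j) has_sum (C * s i) * infsum s UNIV) UNIV" for i
      using in1[of i] by simp
    show "(\<lambda>i. (C * s i) * infsum s UNIV) summable_on UNIV"
      by (intro summable_on_cmult_left summable_on_cmult_right sp)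
  qed (use C s_nonneg in auto)
  then have "(\<lambda>x. norm (case x of (i, j) \<Rightarrow> e i j)) summable_on UNIV \<times> UNIV"
  proof (rule Infinite_Sum.abs_summable_on_comparison_test')
    show "norm (case x of (i, j) \<Rightarrow> e i j) \<le> (case x of (i, j) \<Rightarrow> C * s i * s j)" for x
      by (cases x) (simp only: split bound')
  qed
  then have "(\<lambda>(i, j). e i j) summable_on UNIV \<times> UNIV" by (rule abs_summable_summable)
  then obtain E where E: "((\<lambda>(i, j). e i j) has_sum E) (UNIV \<times> UNIV)" using has_sum_infsum by blast
  have row: "summable (\<lambda>j. norm (e i j))" for i
    by (rule summable_comparison_test'[OF summable_mult[OF s, of "C * s i"]])
       (simp only: real_norm_def abs_norm_cancel bound')
  have col: "summable (\<lambda>i. norm (e i j))" for j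
    by (rule summable_comparison_test'[OF summable_mult2[OF summable_mult[OF s, of C], of "s j"]])
       (simp only: real_norm_def abs_norm_cancel bound')
  have hs: "(f has_sum suminf f) UNIV" if "summable (\<lambda>k. norm (f k))" for f :: "nat \<Rightarrow> complex"
    by (rule norm_summable_imp_has_sum[OF that summable_sums[OF summable_norm_cancel[OF that]]])
  have "((\<lambda>i. \<Sum>j. e i j) has_sum E) UNIV"
    by (rule has_sum_Sigma'[OF E]) (simp only: split hs[OF row])
  moreover have "((\<lambda>(j, i). e i j) has_sum E) (UNIV \<times> UNIV)"
    using iffD1[OF has_sum_swap E] by (simp only: split)
  then have "((\<lambda>j. \<Sum>i. e i j) has_sum E) UNIV"
    by (rule has_sum_Sigma') (simp only: split hs[OF col])
  ultimately show ?thesis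
    by (intro that[OF has_sum_imp_sums has_sum_imp_sums summable_norm_cancel[OF row] summable_norm_cancel[OF col]])
qed

definition E2 :: "complex \<Rightarrow> complex" where
  "E2 z = 1 - 24 * (\<Sum>n. of_nat (divisor_sigma 1 n) * qpar z ^ n)"

lemma qpar_power: "qpar z ^ n = qpar (of_nat n * z)"
  by (simp add: qpar_def exp_of_nat_mult[symmetric] algebra_simps)

text \<open>Only one half of the lattice with both axes removed is summed. In the formula the axis
  \<open>m = 0\<close> accounts for \<open>- 1\<close> and the axis \<open>n = 0\<close> for
  \<open>- 1 / z\<^sup>2\<close>. Without the axes the index set is symmetric in the two
  coordinates, as the inversion requires.\<close>

lemma sums_inverse_square_lattice:
  assumes "Im z > 0"
  shows "(\<lambda>i. \<Sum>j. 1 / (of_nat (Suc i) * z + of_nat (Suc j))\<^sup>2 + 1 / (of_nat (Suc i) * z - of_nat (Suc j))\<^sup>2)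
     sums (of_real pi ^ 2 / 6 * (E2 z - 1 - 1 / z\<^sup>2))"
proof -
  let ?S = "\<lambda>i. \<Sum>j. 1 / (of_nat (Suc i) * z + of_nat (Suc j))\<^sup>2 + 1 / (of_nat (Suc i) * z - of_nat (Suc j))\<^sup>2"
  obtain L where L: "(\<lambda>n. of_nat (divisor_sigma 1 n) * qpar z ^ n) sums L"
    "(\<lambda>m. qpar z ^ Suc m / (1 - qpar z ^ Suc m)\<^sup>2) sums L"
    using lambert_sigma[OF norm_qpar_less_1[OF assms]] by blast
  have "?S i = - 4 * of_real pi ^ 2 * (qpar z ^ Suc i / (1 - qpar z ^ Suc i)\<^sup>2) - of_real (1 / (real i + 1)\<^sup>2) / z\<^sup>2" for i
  proof -
    have "Im (of_nat (Suc i) * z) > 0" using assms by (simp del: of_nat_Suc)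
    from inverse_square_sums_qpar[OF this, THEN sums_unique] show ?thesis
      by (simp add: qpar_power power_mult_distrib add.commute del: power_Suc)
  qed
  moreover have "(\<lambda>i. - 4 * of_real pi ^ 2 * (qpar z ^ Suc i / (1 - qpar z ^ Suc i)\<^sup>2) - of_real (1 / (real i + 1)\<^sup>2) / z\<^sup>2)
      sums (- 4 * of_real pi ^ 2 * L - of_real (pi\<^sup>2 / 6) / z\<^sup>2)"
    using inverse_squares_sums
    by (intro sums_diff sums_mult sums_divide L sums_of_real) (simp add: add.commute)
  ultimately have "?S sums (- 4 * of_real pi ^ 2 * L - of_real (pi\<^sup>2 / 6) / z\<^sup>2)" by simp
  also have "- 4 * of_real pi ^ 2 * L - of_real (pi\<^sup>2 / 6) / z\<^sup>2 = of_real pi ^ 2 / 6 * (E2 z - 1 - 1 / z\<^sup>2)"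
    using L(1) by (simp add: E2_def sums_iff algebra_simps)
  finally show ?thesis .
qed

text \<open>The difference is -1/4 over the product of \<open>v\<close>, \<open>v\<close>,
  \<open>v - 1 / 2\<close> and \<open>v + 1 / 2\<close>. One factor \<open>v\<close> and
  \<open>v - 1 / 2\<close> are bounded below through \<open>M\<close>, the other two through
  \<open>N\<close>; since \<open>\<bar>N\<bar> \<ge> 1\<close>, shifting \<open>N\<close> by 1/2
  loses at most a factor 2.\<close>

lemma inverse_square_diff_bound:
  fixes z :: complex and M N c :: real
  assumes c: "c > 0" "\<And>m n :: real. c * \<bar>m\<bar> \<le> norm (of_real m * z + of_real n)"
    "\<And>m n :: real. c * \<bar>n\<bar> \<le> norm (of_real m * z + of_real n)"
    and MN: "M \<ge> 1" "\<bar>N\<bar> \<ge> 1"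
  defines "v \<equiv> of_real M * z + of_real N"
  shows "norm (1 / v\<^sup>2 - 1 / (v\<^sup>2 - 1 / 4)) \<le> 1 / (2 * c ^ 4) * (1 / M\<^sup>2) * (1 / N\<^sup>2)"
proof -
  have v: "c * M \<le> norm v" "c * \<bar>N\<bar> \<le> norm v"
    using c(2)[of M N] c(3)[of N M] MN by (simp_all add: v_def)
  have eqs: "v + 1 / 2 = of_real M * z + of_real (N + 1 / 2)" "v - 1 / 2 = of_real M * z + of_real (N - 1 / 2)"
    by (simp_all add: v_def)
  have vp: "c * M \<le> norm (v - 1 / 2)" "c * (\<bar>N\<bar> / 2) \<le> norm (v + 1 / 2)"
  proof -
    show "c * M \<le> norm (v - 1 / 2)" using c(2)[of M "N - 1 / 2"] MN unfolding eqs by simp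
    have "\<bar>N\<bar> / 2 \<le> \<bar>N + 1 / 2\<bar>" using MN by (cases "N \<ge> 0") auto
    then have "c * (\<bar>N\<bar> / 2) \<le> c * \<bar>N + 1 / 2\<bar>" using c(1) by (intro mult_left_mono) auto
    also have "\<dots> \<le> norm (v + 1 / 2)" unfolding eqs by (rule c(3))
    finally show "c * (\<bar>N\<bar> / 2) \<le> norm (v + 1 / 2)" .
  qed
  have pos: "0 < c * M" "0 < c * \<bar>N\<bar>" "0 < c * (\<bar>N\<bar> / 2)" using c(1) MN by auto
  then have pos': "0 < norm v" "0 < norm (v - 1 / 2)" "0 < norm (v + 1 / 2)" using v vp by linarith+
  then have nz: "v \<noteq> 0" "v - 1 / 2 \<noteq> 0" "v + 1 / 2 \<noteq> 0" by (simp_all only: zero_less_norm_iff not_False_eq_True)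
  have f: "v\<^sup>2 - 1 / 4 = (v - 1 / 2) * (v + 1 / 2)" by (simp add: algebra_simps power2_eq_square)
  then have nz2: "v\<^sup>2 - 1 / 4 \<noteq> 0" using nz by simp
  then have "1 / v\<^sup>2 - 1 / (v\<^sup>2 - 1 / 4) = - (1 / 4) / (v\<^sup>2 * (v\<^sup>2 - 1 / 4))"
    using nz(1) by (simp add: diff_frac_eq)
  then have "norm (1 / v\<^sup>2 - 1 / (v\<^sup>2 - 1 / 4)) = (1 / 4) / ((norm v * norm v) * (norm (v - 1 / 2) * norm (v + 1 / 2)))"
    unfolding f by (simp add: norm_divide norm_mult power2_eq_square)
  also have "\<dots> \<le> (1 / 4) / (((c * M) * (c * \<bar>N\<bar>)) * ((c * M) * (c * (\<bar>N\<bar> / 2))))"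
    by (intro divide_left_mono mult_mono mult_pos_pos mult_nonneg_nonneg v vp pos pos' norm_ge_zero
        less_imp_le[OF pos(1)] less_imp_le[OF pos(2)] less_imp_le[OF pos(3)]) simp
  also have "((c * M) * (c * \<bar>N\<bar>)) * ((c * M) * (c * (\<bar>N\<bar> / 2))) = c ^ 4 * M\<^sup>2 * N\<^sup>2 / 2"
    by (simp add: power2_eq_square power4_eq_xxxx abs_mult_self_eq)
  also have "(1 / 4) / (c ^ 4 * M\<^sup>2 * N\<^sup>2 / 2) = 1 / (2 * c ^ 4) * (1 / M\<^sup>2) * (1 / N\<^sup>2)"
    by simp
  finally show ?thesis .
qed

text \<open>
  The double series over \<open>1 / (m z + n)\<^sup>2\<close> converges only conditionally, and the anomaly of \<open>E2\<close> is the
  difference of its two iterated sums. Subtracting \<open>1 / ((m z + n)\<^sup>2 - 1 / 4)\<close>, which telescopes in \<open>n\<close>,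
  leaves an absolutely convergent series; the telescoping part is summed in closed form in both
  orders, and the limit of the cotangent produces the extra term.
\<close>

theorem E2_inversion:
  assumes "Im z > 0"
  shows "E2 (- 1 / z) = z\<^sup>2 * E2 z - 6 * \<i> / of_real pi * z"
proof -
  obtain c where c: "c > 0" "\<And>m n :: real. c * \<bar>m\<bar> \<le> norm (of_real m * z + of_real n)"
    "\<And>m n :: real. c * \<bar>n\<bar> \<le> norm (of_real m * z + of_real n)"
    using lattice_lower_bound[OF assms] by blast
  have z0: "z \<noteq> 0" using assms by auto
  define u where "u i = of_nat (Suc i) * z" for i
  define t where "t N = (of_nat N + 1 / 2 :: complex)" for N :: nat
  define b where "b i j = 1 / (u i + of_nat (Suc j))\<^sup>2 + 1 / (u i - of_nat (Suc j))\<^sup>2" for i j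
  \<comment> \<open>With the half-integers \<open>t N\<close>, the partial fraction 1/(x^2 - 1/4) =
    1/(x - 1/2) - 1/(x + 1/2) makes the comparison terms at \<open>Suc j\<close> and
    \<open>- Suc j\<close> combine to \<open>g i (Suc j) - g i j\<close>.\<close>
  define g where "g i N = 1 / (u i - t N) - 1 / (u i + t N)" for i N
  define d where "d i j = g i (Suc j) - g i j" for i j
  define e where "e i j = b i j - d i j" for i j
  \<comment> \<open>The sum of \<open>g i N\<close> over \<open>i\<close>: dividing by
    \<open>z\<close> turns it into the partial fractions of the cotangent at the point
    \<open>t N / z\<close>, which lies in the lower half plane.\<close>
  define G where "G N = - (1 / z) * (of_real pi * cot (of_real pi * (t N / z)) - 1 / (t N / z))" for N
  have u_nz: "u i + of_real x \<noteq> 0" for i x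
  proof
    assume "u i + of_real x = 0"
    then have "Im (u i + of_real x) = 0" by simp
    then show False using assms by (simp add: u_def del: of_nat_Suc)
  qed
  have d_eq: "d i j = 1 / ((u i + of_nat (Suc j))\<^sup>2 - 1 / 4) + 1 / ((u i - of_nat (Suc j))\<^sup>2 - 1 / 4)" for i j
  proof -
    have *: "1 / (x - 1 / 2) - 1 / (x + 1 / 2) = 1 / (x\<^sup>2 - 1 / 4)"
      if "x - 1 / 2 \<noteq> 0" "x + 1 / 2 \<noteq> 0" for x :: complex
    proof -
      have "1 / (x - 1 / 2) - 1 / (x + 1 / 2) = 1 / ((x - 1 / 2) * (x + 1 / 2))"
        using that by (simp add: diff_frac_eq)
      then show ?thesis by (simp add: algebra_simps power2_eq_square)
    qed
    have 1: "u i + of_nat (Suc j) - 1 / 2 = u i + t j" "u i + of_nat (Suc j) + 1 / 2 = u i + t (Suc j)"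
      "u i - of_nat (Suc j) - 1 / 2 = u i - t (Suc j)" "u i - of_nat (Suc j) + 1 / 2 = u i - t j"
      by (simp_all add: t_def field_simps)
    have 2: "u i + t k \<noteq> 0" "u i - t k \<noteq> 0" for k
    proof -
      have "u i + t k = u i + of_real (real k + 1 / 2)" "u i - t k = u i + of_real (- (real k + 1 / 2))"
        by (simp_all add: t_def)
      then show "u i + t k \<noteq> 0" "u i - t k \<noteq> 0" by (simp_all only: u_nz not_False_eq_True)
    qed
    have "d i j = (1 / (u i + t j) - 1 / (u i + t (Suc j))) + (1 / (u i - t (Suc j)) - 1 / (u i - t j))"
      by (simp add: d_def g_def)
    then show ?thesis
      using *[of "u i + of_nat (Suc j)", unfolded 1, OF 2(1) 2(1)]
        *[of "u i - of_nat (Suc j)", unfolded 1, OF 2(2) 2(2)] by (simp only:)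
  qed
  have e_bound: "norm (e i j) \<le> 1 / c ^ 4 * (1 / (real (Suc i))\<^sup>2) * (1 / (real (Suc j))\<^sup>2)" for i j
  proof -
    have "e i j = (1 / (u i + of_nat (Suc j))\<^sup>2 - 1 / ((u i + of_nat (Suc j))\<^sup>2 - 1 / 4))
       + (1 / (u i - of_nat (Suc j))\<^sup>2 - 1 / ((u i - of_nat (Suc j))\<^sup>2 - 1 / 4))"
      by (simp add: e_def b_def d_eq)
    also have "norm \<dots> \<le> 1 / (2 * c ^ 4) * (1 / (real (Suc i))\<^sup>2) * (1 / (real (Suc j))\<^sup>2)
       + 1 / (2 * c ^ 4) * (1 / (real (Suc i))\<^sup>2) * (1 / (real (Suc j))\<^sup>2)"
      using inverse_square_diff_bound[OF c, of "real (Suc i)" "real (Suc j)"]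
        inverse_square_diff_bound[OF c, of "real (Suc i)" "- real (Suc j)"]
      by (intro norm_triangle_mono) (simp_all add: u_def del: of_nat_Suc)
    finally show ?thesis by simp
  qed
  obtain E where E: "(\<lambda>i. \<Sum>j. e i j) sums E" "(\<lambda>j. \<Sum>i. e i j) sums E"
    "\<And>i. summable (\<lambda>j. e i j)" "\<And>j. summable (\<lambda>i. e i j)"
    using sums_swap[OF e_bound] by blast
  have t_inf: "filterlim t at_infinity sequentially"
    unfolding t_def by (intro tendsto_add_filterlim_at_infinity'[OF _ tendsto_const] tendsto_of_nat)
  have g_lim: "g i \<longlonglongrightarrow> 0" for i
  proof -
    have "(\<lambda>N. 1 / (u i + t N)) \<longlonglongrightarrow> 0"
      by (intro tendsto_divide_0[OF tendsto_const] tendsto_add_filterlim_at_infinity[OF tendsto_const] t_inf)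
    moreover have "(\<lambda>N. 1 / (u i + - t N)) \<longlonglongrightarrow> 0"
      by (intro tendsto_divide_0[OF tendsto_const] tendsto_add_filterlim_at_infinity[OF tendsto_const])
         (use t_inf in \<open>simp add: filterlim_at_infinity_conv_norm_at_top\<close>)
    ultimately have "(\<lambda>N. 1 / (u i + - t N) - 1 / (u i + t N)) \<longlonglongrightarrow> 0 - 0" by (intro tendsto_diff)
    then show ?thesis by (simp add: g_def[abs_def])
  qed
  have Im_inv: "Im (1 / z) < 0" 
  proof -
    have "(Re z)\<^sup>2 + (Im z)\<^sup>2 > 0" using assms by (intro add_nonneg_pos) auto
    then show ?thesis using assms by (simp add: Im_divide)
  qed
  have G_sums: "(\<lambda>i. g i N) sums G N" for N
  proof -
    have "t N / z = of_real (real N + 1 / 2) * (1 / z)" by (simp add: t_def)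
    moreover have "Im (of_real r * y) = r * Im y" for r y by simp
    ultimately have "Im (t N / z) = (real N + 1 / 2) * Im (1 / z)" by (simp only:)
    also have "\<dots> \<noteq> 0" using Im_inv by simp
    finally have "t N / z \<notin> \<int>" by (rule not_Ints_Im)
    from sums_mult[OF cot_partial_fractions[OF this], of "- (1 / z)"]
    have "(\<lambda>i. - (1 / z) * (1 / (t N / z + of_nat (Suc i)) + 1 / (t N / z - of_nat (Suc i)))) sums G N"
      by (simp only: G_def)
    also have "(\<lambda>i. - (1 / z) * (1 / (t N / z + of_nat (Suc i)) + 1 / (t N / z - of_nat (Suc i)))) = (\<lambda>i. g i N)"
    proof
      fix i
      have 1: "u i + t N = z * (t N / z + of_nat (Suc i))" "u i - t N = - (z * (t N / z - of_nat (Suc i)))"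
        using z0 by (simp_all add: u_def algebra_simps)
      show "- (1 / z) * (1 / (t N / z + of_nat (Suc i)) + 1 / (t N / z - of_nat (Suc i))) = g i N"
        unfolding g_def 1 by (simp add: distrib_left del: of_nat_Suc)
    qed
    finally show ?thesis .
  qed
  have G_lim: "G \<longlonglongrightarrow> - (of_real pi * \<i> / z)"
  proof -
    have 1: "of_real pi * (t N / z) = of_real pi * (of_nat N + 1 / 2) * (1 / z)" for N
      by (simp add: t_def)
    have 2: "(\<lambda>N. 1 / (t N / z)) \<longlonglongrightarrow> 0"
      using tendsto_divide_0[OF tendsto_const t_inf, of z] by simp
    have "G \<longlonglongrightarrow> - (1 / z) * (of_real pi * \<i> - 0)"
      unfolding G_def 1 using cot_limit_lower[OF Im_inv] 2 by (intro tendsto_intros)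
    then show ?thesis by simp
  qed
  \<comment> \<open>In this order the telescoping is carried out at fixed \<open>i\<close>, where
    \<open>g i\<close> tends to 0, and only the initial value \<open>G 0\<close> survives.\<close>
  have "(\<lambda>i. \<Sum>j. b i j) sums (- G 0 + E)"
  proof -
    have "(\<Sum>j. b i j) = - g i 0 + (\<Sum>j. e i j)" for i
    proof -
      have "(\<lambda>j. d i j) sums (0 - g i 0)" unfolding d_def by (rule telescope_sums[OF g_lim])
      from sums_add[OF this summable_sums[OF E(3)[of i]]] show ?thesis by (simp add: e_def sums_iff)
    qed
    then show ?thesis using sums_add[OF sums_minus[OF G_sums[of 0]] E(1)] by simp
  qed
  with sums_inverse_square_lattice[OF assms]
  have row: "of_real pi ^ 2 / 6 * (E2 z - 1 - 1 / z\<^sup>2) = - G 0 + E"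
    unfolding b_def u_def by (rule sums_unique2)
  \<comment> \<open>In this order \<open>i\<close> is summed first and the telescoping runs along
    \<open>G\<close>, whose limit is not 0. That limit is the whole difference between the two
    iterated sums.\<close>
  have "(\<lambda>j. \<Sum>i. b i j) sums ((- (of_real pi * \<i> / z) - G 0) + E)"
  proof -
    have "(\<Sum>i. b i j) = (G (Suc j) - G j) + (\<Sum>i. e i j)" for j
    proof -
      have "(\<lambda>i. d i j) sums (G (Suc j) - G j)" unfolding d_def by (intro sums_diff G_sums)
      from sums_add[OF this summable_sums[OF E(4)[of j]]] show ?thesis by (simp add: e_def sums_iff)
    qed
    then show ?thesis using sums_add[OF telescope_sums[OF G_lim] E(2)] by simp
  qed
  then have "(\<lambda>j. z\<^sup>2 * (\<Sum>i. b i j)) sums (z\<^sup>2 * ((- (of_real pi * \<i> / z) - G 0) + E))"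
    by (rule sums_mult)
  \<comment> \<open>The factor \<open>z\<^sup>2\<close> turns a column of the lattice of
    \<open>z\<close> into a row of the lattice of \<open>- 1 / z\<close>; the signs disappear in the
    squares.\<close>
  moreover have "z\<^sup>2 * (\<Sum>i. b i j) = (\<Sum>i. 1 / (of_nat (Suc j) * (- 1 / z) + of_nat (Suc i))\<^sup>2
     + 1 / (of_nat (Suc j) * (- 1 / z) - of_nat (Suc i))\<^sup>2)" for j
  proof -
    have s: "summable (\<lambda>i. b i j)"
      using summable_add[OF sums_summable[OF sums_diff[OF G_sums[of "Suc j"] G_sums[of j]]] E(4)[of j]]
      by (simp add: e_def d_def)
    have 1: "of_nat (Suc j) * (- 1 / z) + of_nat (Suc i) = (u i - of_nat (Suc j)) / z"
      "of_nat (Suc j) * (- 1 / z) - of_nat (Suc i) = - ((u i + of_nat (Suc j)) / z)" for i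
      using z0 by (simp_all add: u_def field_simps del: of_nat_Suc)
    have "z\<^sup>2 * b i j = 1 / (of_nat (Suc j) * (- 1 / z) + of_nat (Suc i))\<^sup>2
     + 1 / (of_nat (Suc j) * (- 1 / z) - of_nat (Suc i))\<^sup>2" for i
      unfolding 1 power2_minus power_divide b_def by (simp add: distrib_left del: of_nat_Suc)
    then show ?thesis using suminf_mult[OF s, of "z\<^sup>2"] by simp
  qed
  ultimately have "(\<lambda>j. \<Sum>i. 1 / (of_nat (Suc j) * (- 1 / z) + of_nat (Suc i))\<^sup>2
     + 1 / (of_nat (Suc j) * (- 1 / z) - of_nat (Suc i))\<^sup>2) sums (z\<^sup>2 * ((- (of_real pi * \<i> / z) - G 0) + E))"
    by (simp only:)
  moreover have "Im (- 1 / z) > 0" using Im_inv by simp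
  ultimately have "of_real pi ^ 2 / 6 * (E2 (- 1 / z) - 1 - 1 / (- 1 / z)\<^sup>2) =
      z\<^sup>2 * ((- (of_real pi * \<i> / z) - G 0) + E)"
    using sums_unique2[OF sums_inverse_square_lattice] by blast
  also have "\<dots> = z\<^sup>2 * (of_real pi ^ 2 / 6 * (E2 z - 1 - 1 / z\<^sup>2)) - of_real pi * \<i> * z"
    unfolding row using z0 by (simp add: algebra_simps power2_eq_square)
  also have "z\<^sup>2 * (of_real pi ^ 2 / 6 * (E2 z - 1 - 1 / z\<^sup>2)) = of_real pi ^ 2 / 6 * (z\<^sup>2 * E2 z - z\<^sup>2 - 1)"
    using z0 by (simp add: algebra_simps)
  also have "of_real pi * \<i> * z = of_real pi ^ 2 / 6 * (6 * \<i> / of_real pi * z)"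
    by (simp add: power2_eq_square)
  also have "1 / (- 1 / z)\<^sup>2 = z\<^sup>2" by (simp add: power_divide)
  finally have "of_real pi ^ 2 / 6 * (E2 (- 1 / z) - 1 - z\<^sup>2) =
      of_real pi ^ 2 / 6 * (z\<^sup>2 * E2 z - z\<^sup>2 - 1 - 6 * \<i> / of_real pi * z)"
    by (simp only: right_diff_distrib)
  then have "E2 (- 1 / z) - 1 - z\<^sup>2 = z\<^sup>2 * E2 z - z\<^sup>2 - 1 - 6 * \<i> / of_real pi * z"
    by (subst (asm) mult_left_cancel) simp_all
  then show ?thesis by (simp add: algebra_simps)
qed

subsection \<open>Power series in the variable q\<close>

definition disc_fps :: "complex fps \<Rightarrow> bool" where
  "disc_fps f \<longleftrightarrow> fps_conv_radius f \<ge> 1"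

definition qeval :: "complex fps \<Rightarrow> complex \<Rightarrow> complex" where
  "qeval f z = eval_fps f (qpar z)"

definition theta :: "complex fps \<Rightarrow> complex fps" where
  "theta f = fps_X * fps_deriv f"

definition dilate :: "nat \<Rightarrow> complex fps \<Rightarrow> complex fps" where
  "dilate a f = Abs_fps (\<lambda>n. if a dvd n then fps_nth f (n div a) else 0)"

lemma theta_nth [simp]: "fps_nth (theta f) n = of_nat n * fps_nth f n"
  by (cases n) (simp_all add: theta_def)

lemma dilate_nth [simp]: "fps_nth (dilate a f) n = (if a dvd n then fps_nth f (n div a) else 0)"
  by (simp add: dilate_def)

lemma theta_dilate:
  assumes "a > 0"
  shows "theta (dilate a f) = fps_const (of_nat a) * dilate a (theta f)"
proof (rule fps_ext)
  show "fps_nth (theta (dilate a f)) n = fps_nth (fps_const (of_nat a) * dilate a (theta f)) n" for n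
    using assms by (cases "a dvd n") (auto elim!: dvdE)
qed

lemma disc_fps_summable: "disc_fps f \<Longrightarrow> norm q < 1 \<Longrightarrow> ereal (norm q) < fps_conv_radius f"
  by (metis disc_fps_def ereal_less(3) less_le_trans)

lemma disc_fpsI:
  assumes "\<And>q. norm q < 1 \<Longrightarrow> summable (\<lambda>n. fps_nth f n * q ^ n)"
  shows "disc_fps f"
  unfolding disc_fps_def fps_conv_radius_def
proof (rule conv_radius_geI_ex)
  fix r :: real assume "0 < r" "ereal r < 1"
  then show "\<exists>z. norm z = r \<and> summable (\<lambda>n. fps_nth f n * z ^ n)"
    using assms[of "of_real r"] by (intro exI[of _ "of_real r"]) simp
qed

lemma disc_fps_intros [intro, simp]:
  "disc_fps f \<Longrightarrow> disc_fps g \<Longrightarrow> disc_fps (f + g)"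
  "disc_fps f \<Longrightarrow> disc_fps g \<Longrightarrow> disc_fps (f - g)"
  "disc_fps f \<Longrightarrow> disc_fps g \<Longrightarrow> disc_fps (f * g)"
  "disc_fps (fps_const c)"
  "disc_fps (numeral k)"
  "disc_fps 0"
  "disc_fps f \<Longrightarrow> disc_fps (theta f)"
proof -
  show add: "disc_fps f \<Longrightarrow> disc_fps g \<Longrightarrow> disc_fps (f + g)"
    unfolding disc_fps_def using fps_conv_radius_add[of f g] by (meson min.boundedI order_trans)
  show "disc_fps f \<Longrightarrow> disc_fps g \<Longrightarrow> disc_fps (f - g)"
    unfolding disc_fps_def using fps_conv_radius_diff[of f g] by (meson min.boundedI order_trans)
  have mult: "disc_fps f \<Longrightarrow> disc_fps g \<Longrightarrow> disc_fps (f * g)" for f g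
    unfolding disc_fps_def using fps_conv_radius_mult[of f g] by (meson min.boundedI order_trans)
  then show "disc_fps f \<Longrightarrow> disc_fps g \<Longrightarrow> disc_fps (f * g)" .
  show "disc_fps (fps_const c)" "disc_fps (numeral k)" "disc_fps 0" by (simp_all add: disc_fps_def)
  assume "disc_fps f"
  then have "disc_fps (fps_deriv f)"
    unfolding disc_fps_def using fps_conv_radius_deriv[of f] by (rule order_trans)
  moreover have "disc_fps fps_X" by (simp add: disc_fps_def)
  ultimately show "disc_fps (theta f)" unfolding theta_def by (intro mult)
qed

lemma disc_fps_sum: "(\<And>i. i \<in> I \<Longrightarrow> disc_fps (f i)) \<Longrightarrow> disc_fps (sum f I)"
  by (induction I rule: infinite_finite_induct) auto

lemma sums_dilate:
  assumes "a > 0" "disc_fps f" "norm q < 1"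
  shows "(\<lambda>n. fps_nth (dilate a f) n * q ^ n) sums eval_fps f (q ^ a)"
proof -
  have "norm (q ^ a) < 1" using assms(1,3) by (simp add: norm_power power_less_one_iff)
  then have "(\<lambda>n. fps_nth f n * (q ^ a) ^ n) sums eval_fps f (q ^ a)"
    by (intro sums_eval_fps disc_fps_summable assms(2))
  also have "(\<lambda>n. fps_nth f n * (q ^ a) ^ n) = (\<lambda>n. fps_nth (dilate a f) (a * n) * q ^ (a * n))"
    using assms(1) by (simp add: power_mult)
  also have "\<dots> sums eval_fps f (q ^ a) \<longleftrightarrow> (\<lambda>n. fps_nth (dilate a f) n * q ^ n) sums eval_fps f (q ^ a)"
    by (rule sums_mono_reindex) (use assms(1) in \<open>auto intro: strict_monoI\<close>)
  finally show ?thesis .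
qed

lemma disc_fps_dilate [intro, simp]: "a > 0 \<Longrightarrow> disc_fps f \<Longrightarrow> disc_fps (dilate a f)"
  by (rule disc_fpsI) (rule sums_summable[OF sums_dilate])

lemma qeval_sums: "disc_fps f \<Longrightarrow> Im z > 0 \<Longrightarrow> (\<lambda>n. fps_nth f n * qpar z ^ n) sums qeval f z"
  unfolding qeval_def by (intro sums_eval_fps disc_fps_summable norm_qpar_less_1)

lemma qeval_arith:
  assumes "Im z > 0"
  shows "disc_fps f \<Longrightarrow> disc_fps g \<Longrightarrow> qeval (f + g) z = qeval f z + qeval g z"
    "disc_fps f \<Longrightarrow> disc_fps g \<Longrightarrow> qeval (f - g) z = qeval f z - qeval g z"
    "disc_fps f \<Longrightarrow> disc_fps g \<Longrightarrow> qeval (f * g) z = qeval f z * qeval g z"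
    "qeval (fps_const c) z = c"
    "qeval (numeral k) z = numeral k"
    "qeval 0 z = 0"
  unfolding qeval_def
  by (simp_all add: eval_fps_add eval_fps_diff eval_fps_mult disc_fps_summable norm_qpar_less_1[OF assms])

lemma qeval_sum:
  assumes "Im z > 0" "\<And>i. i \<in> I \<Longrightarrow> disc_fps (f i)"
  shows "qeval (sum f I) z = (\<Sum>i\<in>I. qeval (f i) z)"
  using assms(2)
  by (induction I rule: infinite_finite_induct) (auto simp: qeval_arith[OF assms(1)] disc_fps_sum)

lemma qeval_dilate:
  assumes "Im z > 0" "a > 0" "disc_fps f"
  shows "qeval (dilate a f) z = qeval f (of_nat a * z)"
proof -
  have "(\<lambda>n. fps_nth (dilate a f) n * qpar z ^ n) sums qeval f (of_nat a * z)"
    using sums_dilate[OF assms(2,3) norm_qpar_less_1[OF assms(1)]] by (simp add: qeval_def qpar_power)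
  moreover have "(\<lambda>n. fps_nth (dilate a f) n * qpar z ^ n) sums qeval (dilate a f) z"
    using assms by (intro qeval_sums) auto
  ultimately show ?thesis by (rule sums_unique2[symmetric])
qed

lemma qeval_has_field_derivative:
  assumes "disc_fps f" "Im z > 0"
  shows "(qeval f has_field_derivative 2 * of_real pi * \<i> * qeval (theta f) z) (at z within S)"
proof -
  have "(qpar has_field_derivative qpar z * (2 * of_real pi * \<i>)) (at z within S)"
    unfolding qpar_def by (auto intro!: derivative_eq_intros)
  moreover have "(eval_fps f has_field_derivative eval_fps (fps_deriv f) (qpar z)) (at (qpar z))"
    by (intro has_field_derivative_eval_fps disc_fps_summable norm_qpar_less_1 assms)
  ultimately have "((\<lambda>z. eval_fps f (qpar z)) has_field_derivative
      eval_fps (fps_deriv f) (qpar z) * (qpar z * (2 * of_real pi * \<i>))) (at z within S)"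
    by (rule DERIV_chain2[rotated])
  moreover have "qeval (theta f) z = qpar z * eval_fps (fps_deriv f) (qpar z)"
  proof -
    have "disc_fps (fps_deriv f)"
      using assms(1) unfolding disc_fps_def using fps_conv_radius_deriv[of f] by (rule order_trans)
    moreover have "disc_fps fps_X" by (simp add: disc_fps_def)
    ultimately show ?thesis unfolding theta_def by (subst qeval_arith(3)[OF assms(2)]) (simp_all add: qeval_def)
  qed
  ultimately show ?thesis unfolding qeval_def[abs_def] by (simp add: algebra_simps)
qed

lemma qeval_periodic: "qeval f (z + of_int k) = qeval f z"
proof -
  have "qpar (z + of_int k) = qpar z * exp (of_int k * (2 * of_real pi * \<i>))"
    unfolding qpar_def by (simp add: exp_add[symmetric] algebra_simps)
  also have "exp (of_int k * (2 * of_real pi * \<i>)) = 1"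
    using exp_integer_2pi[of "of_int k"] by (simp add: algebra_simps)
  finally show ?thesis by (simp add: qeval_def)
qed

lemma qeval_bounded:
  assumes "disc_fps f" "y > 0"
  obtains B where "\<And>z. Im z \<ge> y \<Longrightarrow> norm (qeval f z) \<le> B"
proof -
  define r where "r = exp (- 2 * pi * y)"
  have lt: "r < 1" using assms(2) by (simp add: r_def)
  have "compact (eval_fps f ` cball 0 r)"
  proof (rule compact_continuous_image)
    show "continuous_on (cball 0 r) (eval_fps f)"
      by (rule continuous_on_subset[OF continuous_on_eval_fps])
         (auto intro!: disc_fps_summable[OF assms(1)] intro: le_less_trans[OF _ lt])
  qed simp
  then obtain B where B: "\<And>q. q \<in> cball 0 r \<Longrightarrow> norm (eval_fps f q) \<le> B"
    by (meson compact_imp_bounded bounded_iff imageI)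
  show ?thesis
  proof (rule that)
    fix z assume "Im z \<ge> y"
    then show "norm (qeval f z) \<le> B" unfolding qeval_def by (intro B) (simp add: norm_qpar r_def)
  qed
qed

lemma qpar_Ln: "q \<noteq> 0 \<Longrightarrow> qpar (Ln q / (2 * of_real pi * \<i>)) = q"
  by (simp add: qpar_def)

lemma qpar_surj:
  assumes "q \<noteq> 0" "norm q < 1"
  obtains z where "Im z > 0" "qpar z = q"
proof (rule that[of "Ln q / (2 * of_real pi * \<i>)"])
  show "qpar (Ln q / (2 * of_real pi * \<i>)) = q" by (rule qpar_Ln[OF assms(1)])
  have "ln (norm q) < 0" using assms by simp
  moreover have "Ln q / (2 * of_real pi * \<i>) = - (\<i> * Ln q) / of_real (2 * pi)"
    by (simp add: field_simps)
  ultimately show "Im (Ln q / (2 * of_real pi * \<i>)) > 0"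
    using assms(1) by (simp only: Im_divide_of_real) (simp add: field_simps)
qed

text \<open>The upper half plane reaches every point of the unit disc except \<open>q = 0\<close>.
  The value there follows by continuity, and a power series vanishing near 0 is zero.\<close>

lemma qeval_eqD:
  assumes "disc_fps f" "disc_fps g" "\<And>z. Im z > 0 \<Longrightarrow> qeval f z = qeval g z"
  shows "f = g"
proof -
  define h where "h = f - g"
  have h: "disc_fps h" using assms by (simp add: h_def)
  have zero: "eval_fps h q = 0" if q: "q \<noteq> 0" "norm q < 1" for q
  proof -
    obtain z where z: "Im z > 0" "qpar z = q" using qpar_surj[OF q] by blast
    have "qeval h z = 0" using assms z by (simp add: h_def qeval_arith)
    then show ?thesis using z by (simp add: qeval_def)
  qed
  have "isCont (eval_fps h) 0"
    using continuous_on_eval_fps[of h] disc_fps_summable[OF h, of 0]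
    by (simp add: continuous_on_eq_continuous_at zero_ereal_def)
  then have "eval_fps h \<midarrow>0\<rightarrow> eval_fps h 0" by (simp add: isCont_def)
  moreover have "eval_fps h \<midarrow>0\<rightarrow> 0"
  proof (rule tendsto_eventually)
    have "eventually (\<lambda>q. q \<in> ball 0 1 - {0}) (at (0::complex))"
      by (intro eventually_at_in_open) auto
    then show "eventually (\<lambda>q. eval_fps h q = 0) (at 0)"
      by eventually_elim (auto intro: zero)
  qed
  ultimately have "eval_fps h 0 = 0" by (rule LIM_unique)
  with zero have z: "eval_fps h q = 0" if "norm q < 1" for q using that by (cases "q = 0") auto
  have "eventually (\<lambda>q. q \<in> ball 0 1) (nhds (0::complex))" by (intro eventually_nhds_in_open) auto
  then have "eventually (\<lambda>q. eval_fps h q = eval_fps 0 q) (nhds 0)"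
    by eventually_elim (simp add: z)
  moreover have "fps_conv_radius h > 0" using disc_fps_summable[OF h, of 0] by (simp add: zero_ereal_def)
  ultimately have "h = 0" by (intro eval_fps_eqD) auto
  then show ?thesis by (simp add: h_def)
qed

subsection \<open>Eisenstein series of weights 4 and 6\<close>

definition P_fps :: "complex fps" where
  "P_fps = Abs_fps (\<lambda>n. if n = 0 then 1 else - 24 * of_nat (divisor_sigma 1 n))"

definition Q_fps :: "complex fps" where
  "Q_fps = P_fps * P_fps - 12 * theta P_fps"

definition R_fps :: "complex fps" where
  "R_fps = P_fps * Q_fps - 3 * theta Q_fps"

lemma P_fps_nth: "fps_nth P_fps n = (if n = 0 then 1 else - 24 * of_nat (divisor_sigma 1 n))"
  by (simp add: P_fps_def)

lemma sums_P_fps: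
  assumes "norm q < 1"
  shows "(\<lambda>n. fps_nth P_fps n * q ^ n) sums (1 - 24 * (\<Sum>n. of_nat (divisor_sigma 1 n) * q ^ n))"
proof -
  have "(\<lambda>n. (if n = 0 then 1 else 0 :: complex)) sums 1"
    using sums_single[of 0 "\<lambda>_. 1 :: complex"] by simp
  moreover have "(\<lambda>n. of_nat (divisor_sigma 1 n) * q ^ n) sums (\<Sum>n. of_nat (divisor_sigma 1 n) * q ^ n)"
    by (rule lambert_sigma[OF assms]) (simp add: sums_iff)
  ultimately have "(\<lambda>n. (if n = 0 then 1 else 0) - 24 * (of_nat (divisor_sigma 1 n) * q ^ n))
      sums (1 - 24 * (\<Sum>n. of_nat (divisor_sigma 1 n) * q ^ n))"
    by (intro sums_diff sums_mult)
  moreover have "(if n = 0 then 1 else 0) - 24 * (of_nat (divisor_sigma 1 n) * q ^ n) = fps_nth P_fps n * q ^ n" for n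
    by (simp add: P_fps_nth divisor_sigma_def)
  ultimately show ?thesis by (simp only:)
qed

lemma disc_fps_PQR [simp, intro]: "disc_fps P_fps" "disc_fps Q_fps" "disc_fps R_fps"
proof -
  show P: "disc_fps P_fps" by (rule disc_fpsI) (rule sums_summable[OF sums_P_fps])
  then show Q: "disc_fps Q_fps" unfolding Q_fps_def by simp
  show "disc_fps R_fps" unfolding R_fps_def using P Q by simp
qed

lemma qeval_P: "Im z > 0 \<Longrightarrow> qeval P_fps z = E2 z"
  using sums_unique2[OF qeval_sums[OF disc_fps_PQR(1)] sums_P_fps[OF norm_qpar_less_1]]
  by (simp add: E2_def)

text \<open>Squaring \<open>P_fps\<close> gives -48 \<sigma>(n) plus 576 = 48 * 12 times the
  convolution. Besge's formula replaces the latter by 240 \<sigma>_3(n) - 48 (6n - 1) \<sigma>(n),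
  and \<open>- 12 * theta P_fps\<close> contributes 288 n \<sigma>(n), which removes every multiple
  of \<sigma>(n).\<close>

lemma Q_fps_nth: "fps_nth Q_fps n = (if n = 0 then 1 else 240 * of_nat (divisor_sigma 3 n))"
proof (cases "n = 0")
  case False
  let ?s = "\<lambda>n. of_nat (divisor_sigma 1 n) :: complex"
  have P: "fps_nth P_fps k = (if k = 0 then 1 else 0) - 24 * ?s k" for k
    by (simp add: P_fps_nth divisor_sigma_def)
  have "fps_nth (P_fps * P_fps) n = (\<Sum>i\<le>n. (if i = 0 then fps_nth P_fps (n - i) else 0) 
      - (if i = n then 24 * ?s i else 0) + 576 * (?s i * ?s (n - i)))"
    unfolding fps_mult_nth atLeast0AtMost
    by (rule sum.cong) (auto simp: P algebra_simps)
  also have "\<dots> = fps_nth P_fps n - 24 * ?s n + 576 * (\<Sum>i\<le>n. ?s i * ?s (n - i))"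
    by (simp add: sum.distrib sum_subtractf sum_distrib_left)
  finally have 1: "fps_nth (P_fps * P_fps) n = - 48 * ?s n + 576 * (\<Sum>i\<le>n. ?s i * ?s (n - i))"
    using False by (simp add: P)
  have "of_int (12 * (\<Sum>i\<le>n. int (divisor_sigma 1 i * divisor_sigma 1 (n - i)))) =
     (of_int (5 * int (divisor_sigma 3 n) - (6 * int n - 1) * int (divisor_sigma 1 n)) :: complex)"
    unfolding besge ..
  then have *: "12 * (\<Sum>i\<le>n. ?s i * ?s (n - i)) = 5 * of_nat (divisor_sigma 3 n) - (6 * of_nat n - 1) * ?s n"
    by simp
  have 2: "576 * (\<Sum>i\<le>n. ?s i * ?s (n - i)) = 48 * (5 * of_nat (divisor_sigma 3 n) - (6 * of_nat n - 1) * ?s n)"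
  proof -
    have "576 * x = 48 * (12 * x)" for x :: complex by simp
    with * show ?thesis by (simp only:)
  qed
  have "fps_nth Q_fps n = fps_nth (P_fps * P_fps) n - 12 * (of_nat n * fps_nth P_fps n)"
    unfolding Q_fps_def by simp
  then show ?thesis
    unfolding 1 2 using False by (simp add: P_fps_nth algebra_simps)
qed (simp add: Q_fps_def P_fps_nth)

subsection \<open>Modular transformations\<close>

lemma moebius_denominator_nonzero:
  fixes a b c d :: int
  assumes "Im z > 0" "a * d - b * c = 1"
  shows "of_int c * z + of_int d \<noteq> 0"
proof
  assume *: "of_int c * z + of_int d = 0"
  then have "Im (of_int c * z + of_int d) = 0" by simp
  then have "c = 0" using assms(1) by simp
  with * have "d = 0" by simp
  with \<open>c = 0\<close> assms(2) show False by simp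
qed

lemma moebius_Im_pos:
  fixes a b c d :: int
  assumes "Im z > 0" "a * d - b * c = 1"
  shows "Im ((of_int a * z + of_int b) / (of_int c * z + of_int d)) > 0"
proof -
  let ?j = "of_int c * z + of_int d"
  have "?j \<noteq> 0" using moebius_denominator_nonzero[OF assms] .
  then have nj: "(norm ?j)\<^sup>2 > 0" by simp
  have "Im ((of_int a * z + of_int b) * cnj ?j) = of_int (a * d - b * c) * Im z"
    by (simp add: algebra_simps)
  then have "Im ((of_int a * z + of_int b) * cnj ?j) > 0" using assms by simp
  then show ?thesis
    unfolding complex_div_cnj[of _ ?j] using nj
    by (simp only: Im_divide_of_real of_real_power[symmetric] zero_less_divide_iff) simp
qed

lemma E2_periodic: "E2 (z + of_int k) = E2 z" if "Im z > 0"
  using qeval_periodic[of P_fps z k] that by (simp add: qeval_P)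

text \<open>Euclid's algorithm on the bottom row: a translation reduces \<open>d\<close> modulo
  \<open>c\<close>, an inversion moves the remainder to the place of \<open>c\<close>. The induction
  ends at \<open>c = 0\<close>, where the matrix is a translation up to sign.\<close>

theorem E2_modular:
  fixes a b c d :: int
  assumes "a * d - b * c = 1" "Im z > 0"
  shows "E2 ((of_int a * z + of_int b) / (of_int c * z + of_int d)) =
     (of_int c * z + of_int d)\<^sup>2 * E2 z - 6 * \<i> / of_real pi * of_int c * (of_int c * z + of_int d)"
  using assms
proof (induction "nat \<bar>c\<bar>" arbitrary: a b c d z rule: less_induct)
  case less
  show ?case
  proof (cases "c = 0")
    case True
    with less.prems have "a * d = 1" by simp
    then consider "a = 1" "d = 1" | "a = -1" "d = -1" by (auto simp: zmult_eq_1_iff)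
    then show ?thesis
    proof cases
      case 1
      then show ?thesis using True E2_periodic[OF less.prems(2), of b] by simp
    next
      case 2
      then have "(of_int a * z + of_int b) / (of_int c * z + of_int d) = z + of_int (- b)"
        using True by (simp add: field_simps)
      then show ?thesis using True 2 E2_periodic[OF less.prems(2), of "- b"] by simp
    qed
  next
    case False
    define k where "k = d div c"
    define d' where "d' = d - k * c"
    define b' where "b' = b - k * a"
    have "d' = d mod c" unfolding d'_def k_def by (metis minus_div_mult_eq_mod)
    then have "\<bar>d'\<bar> < \<bar>c\<bar>" using False by (simp add: abs_mod_less)
    then have lt: "nat \<bar>- d'\<bar> < nat \<bar>c\<bar>" by simp
    define y where "y = z + of_int k"
    have y: "Im y > 0" using less.prems by (simp add: y_def)
    then have y0: "y \<noteq> 0" by auto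
    \<comment> \<open>The matrix with rows \<open>(- b', a)\<close> and \<open>(- d', c)\<close>,
      applied to \<open>- 1 / y\<close>, has the same value as the given matrix at \<open>z\<close>,
      and its lower left entry is smaller in absolute value than \<open>c\<close>.\<close>
    have det: "(- b') * c - a * (- d') = 1"
      using less.prems(1) by (simp add: b'_def d'_def algebra_simps)
    have "Im (- 1 / y) > 0"
      using moebius_Im_pos[OF y, of 0 0 "-1" 1] by simp
    from less.hyps[OF lt det this]
    have IH: "E2 ((of_int (- b') * (- 1 / y) + of_int a) / (of_int (- d') * (- 1 / y) + of_int c)) =
      (of_int (- d') * (- 1 / y) + of_int c)\<^sup>2 * E2 (- 1 / y)
       - 6 * \<i> / of_real pi * of_int (- d') * (of_int (- d') * (- 1 / y) + of_int c)" .
    define j where "j = of_int c * y + of_int d'"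
    have j: "j = of_int c * z + of_int d" by (simp add: j_def y_def d'_def algebra_simps)
    have e1: "of_int (- d') * (- 1 / y) + of_int c = j / y"
      using y0 by (simp add: j_def field_simps)
    have e2: "of_int (- b') * (- 1 / y) + of_int a = (of_int a * z + of_int b) / y"
      using y0 by (simp add: y_def b'_def field_simps)
    have "E2 ((of_int a * z + of_int b) / j) =
       (j / y)\<^sup>2 * (y\<^sup>2 * E2 y - 6 * \<i> / of_real pi * y) + 6 * \<i> / of_real pi * of_int d' * (j / y)"
      using IH y0 unfolding e1 e2 E2_inversion[OF y] by simp
    also have "(j / y)\<^sup>2 * (y\<^sup>2 * E2 y - 6 * \<i> / of_real pi * y) + 6 * \<i> / of_real pi * of_int d' * (j / y)
       = j\<^sup>2 * E2 y - 6 * \<i> / of_real pi * (j * ((j - of_int d') / y))"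
    proof -
      have "(j / y)\<^sup>2 * (y\<^sup>2 * x - w * y) + w * e * (j / y) = j\<^sup>2 * x - w * (j * ((j - e) / y))" for x w e
        using y0 by (simp add: power2_eq_square diff_divide_distrib algebra_simps)
      then show ?thesis .
    qed
    also have "(j - of_int d') / y = of_int c" using y0 by (simp add: j_def)
    also have "E2 y = E2 z" unfolding y_def by (rule E2_periodic[OF less.prems(2)])
    finally show ?thesis unfolding j[symmetric] by (simp add: algebra_simps)
  qed
qed

lemma moebius_has_field_derivative:
  fixes a b c d :: int
  assumes "a * d - b * c = 1" "Im z > 0"
  shows "((\<lambda>z. (of_int a * z + of_int b) / (of_int c * z + of_int d)) has_field_derivative
     1 / (of_int c * z + of_int d)\<^sup>2) (at z)"
proof -
  let ?j = "of_int c * z + of_int d"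
  have j: "?j \<noteq> 0" using moebius_denominator_nonzero[OF assms(2,1)] .
  have "((\<lambda>z. (of_int a * z + of_int b) / (of_int c * z + of_int d)) has_field_derivative
     (of_int a * ?j - (of_int a * z + of_int b) * of_int c) / (?j * ?j)) (at z)"
    using j by (auto intro!: derivative_eq_intros)
  also have "of_int a * ?j - (of_int a * z + of_int b) * of_int c = of_int (a * d - b * c)"
    by (simp add: algebra_simps)
  finally show ?thesis using assms(1) by (simp add: power2_eq_square)
qed

text \<open>A transformation law is differentiated: the chain rule contributes the derivative of the
  substitution, the inverse square of the automorphy factor, and \<open>theta\<close> is the
  derivative in \<open>z\<close> up to the factor 2 pi \<i>.\<close>

lemma theta_transform:
  fixes a b c d :: int and h :: "complex \<Rightarrow> complex"
  assumes "a * d - b * c = 1" "Im z > 0" "disc_fps f"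
    and eq: "\<And>w. Im w > 0 \<Longrightarrow> qeval f ((of_int a * w + of_int b) / (of_int c * w + of_int d)) = h w"
    and h: "(h has_field_derivative h') (at z)"
  shows "2 * of_real pi * \<i> * qeval (theta f) ((of_int a * z + of_int b) / (of_int c * z + of_int d))
     = (of_int c * z + of_int d)\<^sup>2 * h'"
proof -
  let ?j = "of_int c * z + of_int d"
  let ?g = "\<lambda>z. (of_int a * z + of_int b) / (of_int c * z + of_int d)"
  have j: "?j \<noteq> 0" using moebius_denominator_nonzero[OF assms(2,1)] .
  have 1: "((\<lambda>w. qeval f (?g w)) has_field_derivative 2 * of_real pi * \<i> * qeval (theta f) (?g z) * (1 / ?j\<^sup>2)) (at z)"
    by (rule DERIV_chain2[OF qeval_has_field_derivative moebius_has_field_derivative])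
       (use assms moebius_Im_pos in auto)
  have op: "open {w. Im w > 0}" by (simp add: open_halfspace_Im_gt)
  have "((\<lambda>w. qeval f (?g w)) has_field_derivative h') (at z)"
    by (rule has_field_derivative_transform_within_open[OF h op]) (use assms in auto)
  from DERIV_unique[OF 1 this] show ?thesis using j by (simp add: field_simps)
qed

text \<open>With \<open>tau\<close> equal to 2 pi \<i> the anomaly of P has the coefficient
  \<open>12 / tau\<close>. Differentiating its law creates terms linear and quadratic in
  \<open>c\<close>, and 12 times these are exactly the anomalous terms of the square of P.\<close>

lemma Q_modular:
  fixes a b c d :: int
  assumes "a * d - b * c = 1" "Im z > 0"
  shows "qeval Q_fps ((of_int a * z + of_int b) / (of_int c * z + of_int d)) =
     (of_int c * z + of_int d) ^ 4 * qeval Q_fps z"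
proof -
  let ?g = "(of_int a * z + of_int b) / (of_int c * z + of_int d)"
  define j where "j = of_int c * z + of_int d"
  define tau where "tau = 2 * of_real pi * \<i>"
  have tau0: "tau \<noteq> 0" by (simp add: tau_def)
  have kappa: "- 6 * \<i> / of_real pi = 12 / tau" by (simp add: tau_def field_simps)
  have P: "qeval P_fps ((of_int a * w + of_int b) / (of_int c * w + of_int d)) =
     (of_int c * w + of_int d)\<^sup>2 * qeval P_fps w + 12 / tau * of_int c * (of_int c * w + of_int d)"
    if "Im w > 0" for w
    using E2_modular[OF assms(1) that] moebius_Im_pos[OF that assms(1)] that
    by (simp add: qeval_P kappa[symmetric])
  have dP: "(qeval P_fps has_field_derivative tau * qeval (theta P_fps) z) (at z)"
    unfolding tau_def by (rule qeval_has_field_derivative) (use assms(2) in auto)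
  have "((\<lambda>w. (of_int c * w + of_int d)\<^sup>2 * qeval P_fps w + 12 / tau * of_int c * (of_int c * w + of_int d))
     has_field_derivative 2 * j * of_int c * qeval P_fps z + j\<^sup>2 * (tau * qeval (theta P_fps) z)
       + 12 / tau * of_int c * of_int c) (at z)"
    by (auto intro!: derivative_eq_intros dP simp: j_def tau0 algebra_simps)
  from theta_transform[OF assms disc_fps_PQR(1) P this]
  have "tau * qeval (theta P_fps) ?g = j\<^sup>2 * (2 * j * of_int c * qeval P_fps z + j\<^sup>2 * (tau * qeval (theta P_fps) z)
       + 12 / tau * of_int c * of_int c)"
    by (simp only: j_def tau_def)
  moreover have "X = (j\<^sup>2 * (2 * j * C * p + j\<^sup>2 * (tau * t) + 12 / tau * C * C)) / tau \<Longrightarrow>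
     (j\<^sup>2 * p + 12 / tau * C * j) * (j\<^sup>2 * p + 12 / tau * C * j) - 12 * X = j ^ 4 * (p * p - 12 * t)" for X C p t
  proof -
    assume "X = (j\<^sup>2 * (2 * j * C * p + j\<^sup>2 * (tau * t) + 12 / tau * C * C)) / tau"
    also have "\<dots> = 2 * j ^ 3 * C * p * (1 / tau) + j ^ 4 * t + 12 * C\<^sup>2 * j\<^sup>2 * (1 / tau)\<^sup>2"
      using tau0 by (simp add: field_simps eval_nat_numeral)
    finally have X: "X = 2 * j ^ 3 * C * p * (1 / tau) + j ^ 4 * t + 12 * C\<^sup>2 * j\<^sup>2 * (1 / tau)\<^sup>2" .
    have "12 / tau = 12 * (1 / tau)" by simp
    then show ?thesis unfolding X by (simp only:) (simp add: algebra_simps eval_nat_numeral)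
  qed
  ultimately have "(j\<^sup>2 * qeval P_fps z + 12 / tau * of_int c * j) * (j\<^sup>2 * qeval P_fps z + 12 / tau * of_int c * j)
     - 12 * qeval (theta P_fps) ?g = j ^ 4 * (qeval P_fps z * qeval P_fps z - 12 * qeval (theta P_fps) z)"
    using tau0 by (metis nonzero_mult_div_cancel_left)
  moreover have "qeval Q_fps w = qeval P_fps w * qeval P_fps w - 12 * qeval (theta P_fps) w" if "Im w > 0" for w
    using that by (simp add: Q_fps_def qeval_arith)
  ultimately show ?thesis
    using P[OF assms(2)] assms(2) moebius_Im_pos[OF assms(2,1)] by (simp add: j_def)
qed

text \<open>Differentiating the factor of weight 4 creates a multiple 4 of the term that the anomaly
  of P, with its constant 12, produces in the product with Q. The coefficient 3 = 12 / 4 in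
  \<open>R_fps\<close> makes the two cancel.\<close>

lemma R_modular:
  fixes a b c d :: int
  assumes "a * d - b * c = 1" "Im z > 0"
  shows "qeval R_fps ((of_int a * z + of_int b) / (of_int c * z + of_int d)) =
     (of_int c * z + of_int d) ^ 6 * qeval R_fps z"
proof -
  let ?g = "(of_int a * z + of_int b) / (of_int c * z + of_int d)"
  define j where "j = of_int c * z + of_int d"
  define tau where "tau = 2 * of_real pi * \<i>"
  have tau0: "tau \<noteq> 0" by (simp add: tau_def)
  have kappa: "- 6 * \<i> / of_real pi = 12 / tau" by (simp add: tau_def field_simps)
  have P: "qeval P_fps ?g = j\<^sup>2 * qeval P_fps z + 12 / tau * of_int c * j"
    using E2_modular[OF assms] moebius_Im_pos[OF assms(2,1)] assms(2)
    by (simp add: qeval_P kappa[symmetric] j_def)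
  have "((\<lambda>w. (of_int c * w + of_int d) ^ 4 * qeval Q_fps w)
     has_field_derivative 4 * j ^ 3 * of_int c * qeval Q_fps z + j ^ 4 * (tau * qeval (theta Q_fps) z)) (at z)"
    unfolding j_def tau_def using assms(2)
    by (auto intro!: derivative_eq_intros qeval_has_field_derivative simp: algebra_simps)
  from theta_transform[OF assms disc_fps_PQR(2) Q_modular[OF assms(1)] this]
  have D: "tau * qeval (theta Q_fps) ?g =
     j\<^sup>2 * (4 * j ^ 3 * of_int c * qeval Q_fps z + j ^ 4 * (tau * qeval (theta Q_fps) z))"
    by (simp only: j_def tau_def)
  have "X = (j\<^sup>2 * (4 * j ^ 3 * C * q + j ^ 4 * (tau * t))) / tau \<Longrightarrow>
     (j\<^sup>2 * p + 12 / tau * C * j) * (j ^ 4 * q) - 3 * X = j ^ 6 * (p * q - 3 * t)" for X C p q t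
  proof -
    assume "X = (j\<^sup>2 * (4 * j ^ 3 * C * q + j ^ 4 * (tau * t))) / tau"
    also have "\<dots> = 4 * j ^ 5 * C * q * (1 / tau) + j ^ 6 * t"
      using tau0 by (simp add: field_simps eval_nat_numeral)
    finally have X: "X = 4 * j ^ 5 * C * q * (1 / tau) + j ^ 6 * t" .
    have "12 / tau = 12 * (1 / tau)" by simp
    then show ?thesis unfolding X by (simp only:) (simp add: algebra_simps eval_nat_numeral)
  qed
  with D have "(j\<^sup>2 * qeval P_fps z + 12 / tau * of_int c * j) * (j ^ 4 * qeval Q_fps z)
     - 3 * qeval (theta Q_fps) ?g = j ^ 6 * (qeval P_fps z * qeval Q_fps z - 3 * qeval (theta Q_fps) z)"
    using tau0 by (metis nonzero_mult_div_cancel_left)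
  moreover have "qeval R_fps w = qeval P_fps w * qeval Q_fps w - 3 * qeval (theta Q_fps) w" if "Im w > 0" for w
    using that by (simp add: R_fps_def qeval_arith)
  ultimately show ?thesis
    using P Q_modular[OF assms] assms(2) moebius_Im_pos[OF assms(2,1)] by (simp add: j_def)
qed

text \<open>
  The matrix identity \<open>diag(a, 1) \<gamma> = \<gamma>' (a1, b1; 0, d1)\<close> with \<open>\<gamma>'\<close> of determinant 1 describes the form
  \<open>f(a z)\<close> at the cusp \<open>\<gamma> \<infinity>\<close>.
\<close>

lemma upper_triangular_decomposition:
  fixes \<alpha> \<beta> c d :: int and a :: nat
  assumes "\<alpha> * d - \<beta> * c = 1" "a > 0"
  obtains \<alpha>' \<beta>' c' d' a1 b1 d1 :: int where "\<alpha>' * d' - \<beta>' * c' = 1" "int a * \<alpha> = \<alpha>' * a1"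
    "int a * \<beta> = \<alpha>' * b1 + \<beta>' * d1" "c = c' * a1" "d = c' * b1 + d' * d1" "a1 > 0" "d1 > 0" "a1 * d1 = int a"
proof -
  \<comment> \<open>Dividing the first column of the product matrix by its gcd leaves a coprime
    column, which Bezout's identity completes to a matrix of determinant 1.\<close>
  define g where "g = gcd (int a * \<alpha>) c"
  have "int a * \<alpha> \<noteq> 0 \<or> c \<noteq> 0" using assms by auto
  then have g: "g > 0" by (simp add: g_def)
  define \<alpha>' where "\<alpha>' = (int a * \<alpha>) div g"
  define c' where "c' = c div g"
  have ac: "int a * \<alpha> = \<alpha>' * g" "c = c' * g" by (simp_all add: \<alpha>'_def c'_def g_def)
  have "coprime \<alpha>' c'"
    unfolding \<alpha>'_def c'_def g_def using g by (intro div_gcd_coprime) (auto simp: g_def)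
  then obtain u v where uv: "u * \<alpha>' + v * c' = 1"
    using bezout_int[of \<alpha>' c'] by (metis coprime_iff_gcd_eq_1)
  \<comment> \<open>The entries \<open>b1\<close> and \<open>d1\<close> are the inverse of the
    completed matrix applied to the second column.\<close>
  define b1 where "b1 = u * (int a * \<beta>) + v * d"
  define d1 where "d1 = \<alpha>' * d - c' * (int a * \<beta>)"
  have "g * d1 = (\<alpha>' * g) * d - (c' * g) * (int a * \<beta>)" by (simp add: d1_def algebra_simps)
  also have "\<dots> = int a * (\<alpha> * d - \<beta> * c)" unfolding ac(1)[symmetric] ac(2)[symmetric] by (simp add: algebra_simps)
  finally have gd: "g * d1 = int a" using assms(1) by simp
  then have "d1 > 0" using g assms(2) by (metis of_nat_0_less_iff zero_less_mult_pos)
  moreover have "\<alpha>' * b1 + (- v) * d1 = (u * \<alpha>' + v * c') * (int a * \<beta>)"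
    by (simp add: b1_def d1_def algebra_simps)
  moreover have "c' * b1 + u * d1 = (u * \<alpha>' + v * c') * d"
    by (simp add: b1_def d1_def algebra_simps)
  moreover have "\<alpha>' * u - (- v) * c' = 1" using uv by (simp add: algebra_simps)
  ultimately show ?thesis using ac g gd uv by (intro that[of \<alpha>' u "- v" c' g b1 d1]) simp_all
qed

lemma Im_affine_div: "Im ((of_int k * z + of_int l) / of_int m) = of_int k * Im z / of_int m"
proof -
  have "(of_int m :: complex) = of_real (of_int m)" by simp
  moreover have "Im ((of_int k * z + of_int l) / of_real (of_int m)) = of_int k * Im z / of_int m"
    by (simp only: Im_divide_of_real) simp
  ultimately show ?thesis by (simp only:)
qed

text \<open>The modular laws are applied to the matrix of determinant 1 at \<open>w\<close>, where
  the automorphy factor is \<open>j / d1\<close>. The normalising factor \<open>of_nat a\<close> in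
  the first law makes the anomaly \<open>6 * \<i> / of_real pi * of_int c * j\<close> independent of
  \<open>a\<close>, so that it is the same for two different dilations.\<close>

lemma dilated_modular:
  fixes \<alpha> \<beta> c d \<alpha>' \<beta>' c' d' a1 b1 d1 :: int and a :: nat
  assumes det: "\<alpha>' * d' - \<beta>' * c' = 1"
    and dec: "int a * \<alpha> = \<alpha>' * a1" "int a * \<beta> = \<alpha>' * b1 + \<beta>' * d1" "c = c' * a1" "d = c' * b1 + d' * d1"
    and pos: "a1 > 0" "d1 > 0" "a1 * d1 = int a" and z: "Im z > 0"
  defines "w \<equiv> (of_int a1 * z + of_int b1) / of_int d1"
    and "s \<equiv> of_int a1 / of_int d1" and "j \<equiv> of_int c * z + of_int d"
    and "y \<equiv> of_nat a * ((of_int \<alpha> * z + of_int \<beta>) / (of_int c * z + of_int d))"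
  shows "of_nat a * qeval P_fps y = j\<^sup>2 * (s * qeval P_fps w) - 6 * \<i> / of_real pi * of_int c * j"
    "of_nat a ^ 2 * qeval Q_fps y = j ^ 4 * (s ^ 2 * qeval Q_fps w)"
    "of_nat a ^ 3 * qeval R_fps y = j ^ 6 * (s ^ 3 * qeval R_fps w)"
    "Im w > 0" "Im y > 0"
proof -
  have d1: "of_int d1 \<noteq> (0 :: complex)" using pos by simp
  have "Im w = of_int a1 * Im z / of_int d1"
    unfolding w_def by (rule Im_affine_div)
  then show w: "Im w > 0" using z pos by simp
  have j': "of_int c' * w + of_int d' = j / of_int d1"
    using d1 by (simp add: w_def j_def dec(3,4) field_simps)
  have n': "of_int \<alpha>' * w + of_int \<beta>' = of_nat a * (of_int \<alpha> * z + of_int \<beta>) / of_int d1"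
  proof -
    have "of_nat a * of_int \<alpha> = (of_int \<alpha>' * of_int a1 :: complex)"
      "of_nat a * of_int \<beta> = (of_int \<alpha>' * of_int b1 + of_int \<beta>' * of_int d1 :: complex)"
      using dec(1,2) by (metis of_int_mult of_int_add of_int_of_nat_eq)+
    then have "of_nat a * (of_int \<alpha> * z + of_int \<beta>) = of_int \<alpha>' * (of_int a1 * z + of_int b1) + of_int \<beta>' * of_int d1"
      by (simp add: distrib_left mult.assoc[symmetric])
    then show ?thesis using d1 by (simp add: w_def add_divide_distrib distrib_left)
  qed
  have y: "y = (of_int \<alpha>' * w + of_int \<beta>') / (of_int c' * w + of_int d')"
    unfolding j' n' y_def j_def using d1 by simp
  show yp: "Im y > 0" unfolding y by (rule moebius_Im_pos[OF w det])
  have a: "of_nat a = (of_int a1 * of_int d1 :: complex)"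
    using pos(3) by (metis of_int_mult of_int_of_nat_eq)
  have c: "of_int c = (of_int c' * of_int a1 :: complex)" by (simp add: dec(3))
  have "qeval P_fps y = (j / of_int d1)\<^sup>2 * qeval P_fps w - 6 * \<i> / of_real pi * of_int c' * (j / of_int d1)"
    using E2_modular[OF det w] w yp unfolding y j' by (simp add: qeval_P)
  moreover have "A * D * ((j / D)\<^sup>2 * p - K * C * (j / D)) = j\<^sup>2 * (A / D * p) - K * (C * A) * j"
    if "D \<noteq> 0" for A D K C p :: complex
    using that by (simp add: power2_eq_square algebra_simps)
  ultimately show "of_nat a * qeval P_fps y = j\<^sup>2 * (s * qeval P_fps w) - 6 * \<i> / of_real pi * of_int c * j"
    unfolding a c s_def using d1 by (simp only:) 
  have "(A * D)\<^sup>2 * ((j / D) ^ 4 * p) = j ^ 4 * ((A / D)\<^sup>2 * p)"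
    "(A * D) ^ 3 * ((j / D) ^ 6 * p) = j ^ 6 * ((A / D) ^ 3 * p)"
    if "D \<noteq> 0" for A D p :: complex
    using that by (simp_all add: eval_nat_numeral)
  note * = this[OF d1]
  show "of_nat a ^ 2 * qeval Q_fps y = j ^ 4 * (s ^ 2 * qeval Q_fps w)"
    unfolding a s_def Q_modular[OF det w, folded y, unfolded j'] by (rule *)
  show "of_nat a ^ 3 * qeval R_fps y = j ^ 6 * (s ^ 3 * qeval R_fps w)"
    unfolding a s_def R_modular[OF det w, folded y, unfolded j'] by (rule *)
qed

text \<open>
  The quasimodular variables \<open>p\<close> and \<open>p'\<close> enter only through \<open>p - p'\<close>, so the common shift that they
  acquire under a modular substitution cancels.
\<close>

definition weight6_poly :: "complex \<Rightarrow> complex \<Rightarrow> complex \<Rightarrow> complex \<Rightarrow> complex \<Rightarrow> complex \<Rightarrow> complex" where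
  "weight6_poly p p' q q' r r' =
     - ((p - p') ^ 3) / 12 + q * (p' - p) / 12 + q' * (p - p') / 4 + (r + r') / 6"

lemma weight6_poly_homogeneous:
  "weight6_poly (j\<^sup>2 * p - x) (j\<^sup>2 * p' - x) (j ^ 4 * q) (j ^ 4 * q') (j ^ 6 * r) (j ^ 6 * r') =
     j ^ 6 * weight6_poly p p' q q' r r'"
proof -
  have "(j\<^sup>2 * p - x) - (j\<^sup>2 * p' - x) = j\<^sup>2 * (p - p')" "(j\<^sup>2 * p' - x) - (j\<^sup>2 * p - x) = j\<^sup>2 * (p' - p)"
    by (simp_all add: right_diff_distrib)
  moreover have "(j\<^sup>2 * (p - p')) ^ 3 = j ^ 6 * (p - p') ^ 3"
    by (simp add: power_mult_distrib power_mult[symmetric])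
  moreover have "j ^ 4 * u * (j\<^sup>2 * v) = j ^ 6 * (u * v)" for u v
    by (simp add: eval_nat_numeral)
  ultimately show ?thesis unfolding weight6_poly_def
    by (simp only:) (simp add: algebra_simps)
qed

definition weight6_form :: "nat \<Rightarrow> nat \<Rightarrow> complex \<Rightarrow> complex" where
  "weight6_form a b z = (if Im z > 0 then
     weight6_poly (of_nat a * qeval P_fps (of_nat a * z)) (of_nat b * qeval P_fps (of_nat b * z))
       (of_nat a ^ 2 * qeval Q_fps (of_nat a * z)) (of_nat b ^ 2 * qeval Q_fps (of_nat b * z))
       (of_nat a ^ 3 * qeval R_fps (of_nat a * z)) (of_nat b ^ 3 * qeval R_fps (of_nat b * z))
     else 0)"

lemma norm_weight6_poly_le:
  assumes "norm p \<le> P" "norm p' \<le> P'" "norm q \<le> Q" "norm q' \<le> Q'" "norm r \<le> R" "norm r' \<le> R'"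
  shows "norm (weight6_poly p p' q q' r r') \<le> (P + P') ^ 3 + Q * (P + P') + Q' * (P + P') + (R + R')"
proof -
  have d: "norm (p - p') \<le> P + P'" "norm (p' - p) \<le> P + P'"
    using norm_triangle_ineq4[of p p'] norm_triangle_ineq4[of p' p] assms by linarith+
  have 1: "norm (- ((p - p') ^ 3) / 12) \<le> (P + P') ^ 3"
  proof -
    have "norm (- ((p - p') ^ 3) / 12) \<le> norm (p - p') ^ 3" by (simp add: norm_divide norm_power)
    also have "\<dots> \<le> (P + P') ^ 3" by (intro power_mono d) simp
    finally show ?thesis .
  qed
  have m: "norm (u * v / k) \<le> U * V" if "norm u \<le> U" "norm v \<le> V" "norm k \<ge> 1" for u v k :: complex and U V
  proof -
    have "norm (u * v / k) \<le> norm u * norm v"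
    proof -
      have "k \<noteq> 0" using that(3) by auto
      then show ?thesis
        using divide_left_mono[OF that(3), of "norm u * norm v"] by (simp add: norm_divide norm_mult)
    qed
    also have "\<dots> \<le> U * V" using that by (intro mult_mono) (auto intro: order_trans[OF norm_ge_zero])
    finally show ?thesis .
  qed
  have "norm ((r + r') / 6) \<le> R + R'"
  proof -
    have "norm ((r + r') / 6) \<le> norm (r + r')" by (simp add: norm_divide)
    then show ?thesis using norm_triangle_ineq[of r r'] assms(5,6) by linarith
  qed
  then show ?thesis
    unfolding weight6_poly_def
    by (intro norm_triangle_mono 1 m d assms) simp_all
qed

text \<open>The formula holds for every matrix of SL_2(Z) and any choice of the two decompositions.
  It serves both the invariance, with diagonal decompositions, and the boundedness at all
  cusps.\<close>

lemma slash_weight6_form: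
  fixes \<alpha> \<beta> c d \<alpha>1 \<beta>1 c1 d1 a1 b1 e1 \<alpha>2 \<beta>2 c2 d2 a2 b2 e2 :: int and a b :: nat
  assumes det: "\<alpha> * d - \<beta> * c = 1"
    and 1: "\<alpha>1 * d1 - \<beta>1 * c1 = 1" "int a * \<alpha> = \<alpha>1 * a1" "int a * \<beta> = \<alpha>1 * b1 + \<beta>1 * e1" "c = c1 * a1" 
      "d = c1 * b1 + d1 * e1" "a1 > 0" "e1 > 0" "a1 * e1 = int a" 
    and 2: "\<alpha>2 * d2 - \<beta>2 * c2 = 1" "int b * \<alpha> = \<alpha>2 * a2" "int b * \<beta> = \<alpha>2 * b2 + \<beta>2 * e2" "c = c2 * a2" 
      "d = c2 * b2 + d2 * e2" "a2 > 0" "e2 > 0" "a2 * e2 = int b" 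
    and z: "Im z > 0"
  defines "w1 \<equiv> (of_int a1 * z + of_int b1) / of_int e1" and "s1 \<equiv> of_int a1 / of_int e1"
    and "w2 \<equiv> (of_int a2 * z + of_int b2) / of_int e2" and "s2 \<equiv> of_int a2 / of_int e2"
  shows "slash 6 \<alpha> \<beta> c d (weight6_form a b) z =
     weight6_poly (s1 * qeval P_fps w1) (s2 * qeval P_fps w2) (s1 ^ 2 * qeval Q_fps w1) (s2 ^ 2 * qeval Q_fps w2)
       (s1 ^ 3 * qeval R_fps w1) (s2 ^ 3 * qeval R_fps w2)"
proof -
  define j where "j = of_int c * z + of_int d"
  have j: "j \<noteq> 0" unfolding j_def by (rule moebius_denominator_nonzero[OF z det])
  note d1 = dilated_modular[OF 1 z, folded w1_def s1_def j_def]
  note d2 = dilated_modular[OF 2 z, folded w2_def s2_def j_def]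
  have "Im ((of_int \<alpha> * z + of_int \<beta>) / j) > 0" unfolding j_def by (rule moebius_Im_pos[OF z det])
  then have "slash 6 \<alpha> \<beta> c d (weight6_form a b) z = j powi (- 6) * (j ^ 6 *
     weight6_poly (s1 * qeval P_fps w1) (s2 * qeval P_fps w2) (s1 ^ 2 * qeval Q_fps w1) (s2 ^ 2 * qeval Q_fps w2)
       (s1 ^ 3 * qeval R_fps w1) (s2 ^ 3 * qeval R_fps w2))"
    unfolding slash_def weight6_form_def j_def[symmetric]
    by (simp only: if_True d1 d2 weight6_poly_homogeneous)
  then show ?thesis using j by (simp add: power_int_minus)
qed

theorem weight6_form_modular:
  assumes "a > 0" "b > 0"
  shows "weight6_form a b \<in> modular_forms 6 (a * b)"
  unfolding modular_forms_def
proof (intro CollectI conjI allI impI ballI)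
  show "weight6_form a b z = 0" if "z \<notin> upper_half_plane" for z
    using that by (simp add: weight6_form_def upper_half_plane_def)
  have hol: "(\<lambda>z. qeval f (of_nat k * z)) holomorphic_on upper_half_plane" if "disc_fps f" "k > 0" for f k
  proof -
    have "qeval f holomorphic_on upper_half_plane"
      unfolding holomorphic_on_def field_differentiable_def upper_half_plane_def
      using qeval_has_field_derivative[OF that(1)] by blast
    moreover have "(\<lambda>z. of_nat k * z) ` upper_half_plane \<subseteq> upper_half_plane"
      using that(2) by (auto simp: upper_half_plane_def)
    ultimately show ?thesis
      using holomorphic_on_compose_gen[of "\<lambda>z. of_nat k * z" upper_half_plane "qeval f" upper_half_plane]
      by (auto simp: o_def intro!: holomorphic_intros)
  qed
  have "(\<lambda>z. weight6_poly (of_nat a * qeval P_fps (of_nat a * z)) (of_nat b * qeval P_fps (of_nat b * z))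
       (of_nat a ^ 2 * qeval Q_fps (of_nat a * z)) (of_nat b ^ 2 * qeval Q_fps (of_nat b * z))
       (of_nat a ^ 3 * qeval R_fps (of_nat a * z)) (of_nat b ^ 3 * qeval R_fps (of_nat b * z)))
     holomorphic_on upper_half_plane"
    unfolding weight6_poly_def using assms by (intro holomorphic_intros hol disc_fps_PQR) auto
  then show "weight6_form a b holomorphic_on upper_half_plane"
    by (rule holomorphic_transform) (simp add: weight6_form_def upper_half_plane_def)
next
  fix \<alpha> \<beta> c d :: int and z
  assume *: "\<alpha> * d - \<beta> * c = 1 \<and> int (a * b) dvd c" and "z \<in> upper_half_plane"
  then have z: "Im z > 0" by (simp add: upper_half_plane_def)
  have "int a dvd c" "int b dvd c" using * by (auto elim: dvd_mult_left dvd_mult_right)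
  then obtain c1 c2 where c: "c = c1 * int a" "c = c2 * int b" by (metis dvd_def mult.commute)
  \<comment> \<open>As \<open>a\<close> and \<open>b\<close> divide \<open>c\<close>, the
    decompositions can be taken with triangular parts diag(a, 1) and diag(b, 1): the entry \<beta>
    is multiplied and \<open>c\<close> divided by the dilation factor.\<close>
  have "slash 6 \<alpha> \<beta> c d (weight6_form a b) z =
    weight6_poly (of_int (int a) / of_int 1 * qeval P_fps ((of_int (int a) * z + of_int 0) / of_int 1))
     (of_int (int b) / of_int 1 * qeval P_fps ((of_int (int b) * z + of_int 0) / of_int 1))
     ((of_int (int a) / of_int 1) ^ 2 * qeval Q_fps ((of_int (int a) * z + of_int 0) / of_int 1))
     ((of_int (int b) / of_int 1) ^ 2 * qeval Q_fps ((of_int (int b) * z + of_int 0) / of_int 1))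
     ((of_int (int a) / of_int 1) ^ 3 * qeval R_fps ((of_int (int a) * z + of_int 0) / of_int 1))
     ((of_int (int b) / of_int 1) ^ 3 * qeval R_fps ((of_int (int b) * z + of_int 0) / of_int 1))"
  proof (rule slash_weight6_form)
    show "\<alpha> * d - \<beta> * c = 1" using * by simp
    show "\<alpha> * d - (int a * \<beta>) * c1 = 1" "\<alpha> * d - (int b * \<beta>) * c2 = 1"
      using * c by (auto simp: algebra_simps)
  qed (use c assms z in auto)
  then show "slash 6 \<alpha> \<beta> c d (weight6_form a b) z = weight6_form a b z"
    using z by (simp add: weight6_form_def)
next
  fix \<alpha> \<beta> c d :: int
  assume det: "\<alpha> * d - \<beta> * c = 1"
  obtain \<alpha>1 \<beta>1 c1 d1 a1 b1 e1 where 1: "\<alpha>1 * d1 - \<beta>1 * c1 = 1" "int a * \<alpha> = \<alpha>1 * a1" 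
      "int a * \<beta> = \<alpha>1 * b1 + \<beta>1 * e1" "c = c1 * a1" "d = c1 * b1 + d1 * e1" "a1 > 0" "e1 > 0" "a1 * e1 = int a" 
    by (rule upper_triangular_decomposition[OF det assms(1)])
  obtain \<alpha>2 \<beta>2 c2 d2 a2 b2 e2 where 2: "\<alpha>2 * d2 - \<beta>2 * c2 = 1" "int b * \<alpha> = \<alpha>2 * a2" 
      "int b * \<beta> = \<alpha>2 * b2 + \<beta>2 * e2" "c = c2 * a2" "d = c2 * b2 + d2 * e2" "a2 > 0" "e2 > 0" "a2 * e2 = int b" 
    by (rule upper_triangular_decomposition[OF det assms(2)])
  obtain BP where BP: "\<And>z. Im z \<ge> 1 \<Longrightarrow> norm (qeval P_fps z) \<le> BP" 
    using qeval_bounded[OF disc_fps_PQR(1) zero_less_one] by metis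
  obtain BQ where BQ: "\<And>z. Im z \<ge> 1 \<Longrightarrow> norm (qeval Q_fps z) \<le> BQ" 
    using qeval_bounded[OF disc_fps_PQR(2) zero_less_one] by metis
  obtain BR where BR: "\<And>z. Im z \<ge> 1 \<Longrightarrow> norm (qeval R_fps z) \<le> BR" 
    using qeval_bounded[OF disc_fps_PQR(3) zero_less_one] by metis
  define s1 :: complex where "s1 = of_int a1 / of_int e1"
  define s2 :: complex where "s2 = of_int a2 / of_int e2"
  define P1 P2 Q1 Q2 R1 R2 where defs: "P1 = norm s1 * BP" "P2 = norm s2 * BP" "Q1 = norm s1 ^ 2 * BQ"
     "Q2 = norm s2 ^ 2 * BQ" "R1 = norm s1 ^ 3 * BR" "R2 = norm s2 ^ 3 * BR"
  \<comment> \<open>Above the height \<open>m / k\<close> the affine image has imaginary part at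
    least 1, which brings it into the region where \<open>BP\<close>, \<open>BQ\<close> and
    \<open>BR\<close> are bounds.\<close>
  have big: "Im ((of_int k * z + of_int l) / of_int m) \<ge> 1" if "k > 0" "m > 0" "Im z \<ge> of_int m / of_int k"
    for k l m :: int and z
  proof -
    have "Im ((of_int k * z + of_int l) / of_int m) = of_int k * Im z / of_int m"
      by (rule Im_affine_div)
    then show ?thesis using that by (simp add: field_simps)
  qed
  show "\<exists>B Y. \<forall>z\<in>upper_half_plane. Im z \<ge> Y \<longrightarrow> norm (slash 6 \<alpha> \<beta> c d (weight6_form a b) z) \<le> B"
  proof (intro exI ballI impI)
    fix z assume z: "z \<in> upper_half_plane" "Im z \<ge> max (of_int e1 / of_int a1) (of_int e2 / of_int a2)"
    define w1 where "w1 = (of_int a1 * z + of_int b1) / of_int e1"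
    define w2 where "w2 = (of_int a2 * z + of_int b2) / of_int e2"
    have w: "Im w1 \<ge> 1" "Im w2 \<ge> 1" 
      unfolding w1_def w2_def using big[OF 1(6,7)] big[OF 2(6,7)] z(2) by simp_all
    have "Im z > 0" using z by (simp add: upper_half_plane_def)
    note eq = slash_weight6_form[OF det 1 2 this, folded s1_def s2_def w1_def w2_def]
    show "norm (slash 6 \<alpha> \<beta> c d (weight6_form a b) z) \<le> (P1 + P2) ^ 3 + Q1 * (P1 + P2) + Q2 * (P1 + P2) + (R1 + R2)"
      unfolding eq
      by (rule norm_weight6_poly_le) (auto simp: defs norm_mult norm_power intro!: mult_left_mono BP BQ BR w)
  qed
qed

subsection \<open>Fourier expansions of modular forms\<close>

lemma qpar_eq_imp_int_diff:
  assumes "qpar z = qpar w"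
  obtains k :: int where "z = w + of_int k"
proof -
  from assms obtain k :: int where "2 * of_real pi * \<i> * z = 2 * of_real pi * \<i> * w + of_int (2 * k) * (of_real pi * \<i>)"
    unfolding qpar_def by (auto simp: exp_eq)
  then have "2 * of_real pi * \<i> * z = 2 * of_real pi * \<i> * (w + of_int k)" by (simp add: algebra_simps)
  then have "z = w + of_int k" by (simp only: mult_cancel_left) simp
  then show ?thesis by (rule that)
qed

text \<open>By periodicity \<open>f\<close> descends to a holomorphic function \<open>h\<close> of
  \<open>q\<close> on the punctured disc. Boundedness at large height makes the singularity at
  \<open>q = 0\<close> removable, and the Taylor series of the extension is the expansion.\<close>

theorem periodic_holomorphic_q_expansion:
  assumes hol: "f holomorphic_on {z. Im z > 0}"
    and per: "\<And>z. Im z > 0 \<Longrightarrow> f (z + 1) = f z"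
    and bdd: "\<And>z. Im z > 0 \<Longrightarrow> Im z \<ge> Y \<Longrightarrow> norm (f z) \<le> B"
  obtains F where "disc_fps F" "\<And>z. Im z > 0 \<Longrightarrow> f z = qeval F z"
proof -
  have per_nat: "f (z + of_nat k) = f z" if "Im z > 0" for z k
  proof (induction k)
    case (Suc k)
    have "f (z + of_nat (Suc k)) = f (z + of_nat k + 1)" by (simp add: algebra_simps)
    also have "\<dots> = f (z + of_nat k)" using that by (intro per) simp
    finally show ?case using Suc by simp
  qed simp
  have per_int: "f (z + of_int k) = f z" if "Im z > 0" for z k
  proof (cases "k \<ge> 0")
    case True
    then show ?thesis using per_nat[OF that, of "nat k"] by simp
  next
    case False
    have "Im (z + of_int k) > 0" using that by simp
    from per_nat[OF this, of "nat (- k)"] show ?thesis using False by simp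
  qed
  have cong: "f z = f w" if zw: "qpar z = qpar w" "Im z > 0" for z w
  proof -
    obtain k where k: "w = z + of_int k" by (rule qpar_eq_imp_int_diff[OF zw(1)[symmetric]])
    show ?thesis unfolding k by (rule per_int[OF zw(2), symmetric])
  qed
  define L where "L q = Ln q / (2 * of_real pi * \<i>)" for q
  define h where "h q = f (L q)" for q
  have Im_pos: "Im z > 0" if "norm (qpar z) < 1" for z
    using that by (simp add: norm_qpar zero_less_mult_iff)
  have L: "qpar (L q) = q" "Im (L q) > 0" if "q \<noteq> 0" "norm q < 1" for q
  proof -
    show "qpar (L q) = q" unfolding L_def by (rule qpar_Ln[OF that(1)])
    then show "Im (L q) > 0" using that(2) by (intro Im_pos) simp
  qed
  define D where "D = ball (0 :: complex) 1 - {0}"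
  have D: "q \<noteq> 0" "norm q < 1" if "q \<in> D" for q using that by (auto simp: D_def)
  have h_qpar: "h (qpar z) = f z" if "Im z > 0" for z
    unfolding h_def using L[of "qpar z"] norm_qpar_less_1[OF that] by (intro cong) simp_all
  have oD: "open D" by (auto simp: D_def)
  \<comment> \<open>Two branches of the logarithm, cut along opposite rays, cover the punctured disc.\<close>
  have 1: "h holomorphic_on D - \<real>\<^sub>\<le>\<^sub>0"
  proof -
    have "L holomorphic_on D - \<real>\<^sub>\<le>\<^sub>0" unfolding L_def by (intro holomorphic_intros) auto
    moreover have "L ` (D - \<real>\<^sub>\<le>\<^sub>0) \<subseteq> {z. Im z > 0}" using L(2) D by auto
    ultimately show ?thesis
      using holomorphic_on_compose_gen[OF _ hol, of L] by (simp add: h_def[abs_def] o_def)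
  qed
  have 2: "h holomorphic_on D - \<real>\<^sub>\<ge>\<^sub>0"
  proof (rule holomorphic_transform)
    \<comment> \<open>Adding 1/2 multiplies the value of \<open>qpar\<close> by -1 and so undoes the
      sign in \<open>L (- q)\<close>; the cut of this branch lies along the nonnegative
      reals.\<close>
    have "(\<lambda>q. L (- q) + 1 / 2) holomorphic_on D - \<real>\<^sub>\<ge>\<^sub>0"
      unfolding L_def by (intro holomorphic_intros) auto
    moreover have im: "Im (L (- q) + 1 / 2) > 0" if "q \<in> D" for q using L(2)[of "- q"] D[OF that] by simp
    ultimately show "(\<lambda>q. f (L (- q) + 1 / 2)) holomorphic_on D - \<real>\<^sub>\<ge>\<^sub>0"
      using holomorphic_on_compose_gen[OF _ hol, of "\<lambda>q. L (- q) + 1 / 2"] by (simp add: o_def image_subset_iff)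
    fix q assume "q \<in> D - \<real>\<^sub>\<ge>\<^sub>0"
    then have q: "q \<in> D" by simp
    have "qpar (L (- q) + 1 / 2) = qpar (L (- q)) * exp (of_real pi * \<i>)"
      unfolding qpar_def exp_add[symmetric] by (rule arg_cong[of _ _ exp]) (simp add: algebra_simps)
    also have "\<dots> = q" using L(1)[of "- q"] D[OF q] by simp
    finally show "f (L (- q) + 1 / 2) = h q" using h_qpar[OF im[OF q]] by simp
  qed
  have "h holomorphic_on (D - \<real>\<^sub>\<le>\<^sub>0) \<union> (D - \<real>\<^sub>\<ge>\<^sub>0)"
    by (intro holomorphic_on_Un 1 2 open_Diff oD) auto
  also have "(D - \<real>\<^sub>\<le>\<^sub>0) \<union> (D - \<real>\<^sub>\<ge>\<^sub>0) = D"
    by (auto simp: D_def complex_nonpos_Reals_iff complex_nonneg_Reals_iff complex_eq_iff)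
  finally have hD: "h holomorphic_on D" .
  have "\<forall>\<^sub>F q in at 0. norm (h q) \<le> B"
  proof -
    have "eventually (\<lambda>q. q \<in> ball 0 (min 1 (exp (- 2 * pi * Y))) - {0}) (at (0::complex))"
      by (intro eventually_at_in_open) auto
    then show ?thesis
    proof eventually_elim
      case (elim q)
      then have q: "q \<noteq> 0" "norm q < 1" "norm q < exp (- 2 * pi * Y)" by auto
      have "exp (- 2 * pi * Im (L q)) < exp (- 2 * pi * Y)"
        using q(3) L(1)[OF q(1,2)] norm_qpar[of "L q"] by simp
      then have "Im (L q) \<ge> Y" by simp
      then show ?case unfolding h_def using L(2)[OF q(1,2)] by (intro bdd)
    qed
  qed
  then have "\<exists>g. g holomorphic_on ball 0 1 \<and> (\<forall>z\<in>ball 0 1 - {0}. g z = h z)"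
    using hD by (subst holomorphic_on_extend_bounded) (auto simp: D_def)
  then obtain g where g: "g holomorphic_on ball 0 1" "\<And>q. q \<in> D \<Longrightarrow> g q = h q"
    by (auto simp: D_def)
  define F where "F = Abs_fps (\<lambda>n. (deriv ^^ n) g 0 / fact n)"
  have F: "(\<lambda>n. fps_nth F n * q ^ n) sums g q" if "norm q < 1" for q
    using holomorphic_power_series[OF g(1), of q] that by (simp add: F_def)
  show ?thesis
  proof (rule that)
    show dF: "disc_fps F" by (rule disc_fpsI) (rule sums_summable[OF F])
    fix z assume z: "Im z > 0"
    have "qpar z \<in> D" using norm_qpar_less_1[OF z] by (simp add: D_def)
    then have "g (qpar z) = f z" using g(2) h_qpar[OF z] by simp
    moreover have "g (qpar z) = qeval F z"
      using sums_unique2[OF F[OF norm_qpar_less_1[OF z]] qeval_sums[OF dF z]] .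
    ultimately show "f z = qeval F z" by simp
  qed
qed

text \<open>The definite description needs uniqueness. A competing sequence converges at every point
  of the upper half plane, hence on the whole unit disc, and \<open>qeval_eqD\<close>
  applies.\<close>

lemma fourier_coeff_qeval:
  assumes "disc_fps F" "\<And>z. Im z > 0 \<Longrightarrow> f z = qeval F z"
  shows "fourier_coeff f = fps_nth F"
  unfolding fourier_coeff_def
proof (rule the_equality)
  show "\<forall>z\<in>upper_half_plane. (\<lambda>n. fps_nth F n * exp (2 * of_real pi * \<i> * z) ^ n) sums f z"
    using qeval_sums[OF assms(1)] assms(2) by (simp add: upper_half_plane_def qpar_def)
  fix c :: "nat \<Rightarrow> complex"
  assume c: "\<forall>z\<in>upper_half_plane. (\<lambda>n. c n * exp (2 * of_real pi * \<i> * z) ^ n) sums f z"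
  define C where "C = Abs_fps c"
  have sums: "(\<lambda>n. fps_nth C n * qpar z ^ n) sums f z" if "Im z > 0" for z
    using c that by (simp add: C_def upper_half_plane_def qpar_def)
  have dC: "disc_fps C"
  proof (rule disc_fpsI)
    fix q :: complex assume q: "norm q < 1"
    show "summable (\<lambda>n. fps_nth C n * q ^ n)"
    proof (cases "q = 0")
      case True
      then show ?thesis by simp
    next
      case False
      then obtain z where "Im z > 0" "qpar z = q" using qpar_surj q by metis
      then show ?thesis using sums[of z] by (auto dest: sums_summable)
    qed
  qed
  have "C = F"
    by (rule qeval_eqD[OF dC assms(1)]) (metis sums_unique2 sums qeval_sums dC assms(2))
  then show "c = fps_nth F" by (auto simp: C_def)
qed

lemma modular_form_q_expansion:
  assumes "f \<in> modular_forms k N"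
  obtains F where "disc_fps F" "\<And>z. Im z > 0 \<Longrightarrow> f z = qeval F z"
proof -
  obtain B Y where B: "\<And>z. z \<in> upper_half_plane \<Longrightarrow> Im z \<ge> Y \<Longrightarrow> norm (slash k 1 0 0 1 f z) \<le> B"
    by (rule modular_forms_bounded[OF assms, of 1 1 0 0]) auto
  have hol: "f holomorphic_on {z. Im z > 0}"
    using assms by (simp add: modular_forms_def upper_half_plane_def)
  have per: "f (z + 1) = f z" if "Im z > 0" for z
    using modular_forms_slash[OF assms, of 1 1 1 0 z] that by (simp add: upper_half_plane_def slash_def)
  have bdd: "norm (f z) \<le> B" if "Im z > 0" "Im z \<ge> Y" for z
    using B[of z] that by (simp add: upper_half_plane_def slash_def)
  show ?thesis using periodic_holomorphic_q_expansion[OF hol per bdd] that by metis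
qed

subsection \<open>The convolution formula\<close>

text \<open>The two ends of the Cauchy product pair a coefficient with a constant term; they produce
  the single divisor sums of the final formula. An inner index contributes only if \<open>a\<close>
  divides it and \<open>b\<close> divides its complement.\<close>

lemma dilate_mult_nth:
  assumes "a > 0" "b > 0" "n > 0"
  shows "fps_nth (dilate a f * dilate b g) n = fps_nth f 0 * fps_nth (dilate b g) n
    + fps_nth (dilate a f) n * fps_nth g 0 + (\<Sum>(l, m)\<in>sols a b n. fps_nth f l * fps_nth g m)"
proof -
  let ?t = "\<lambda>i. fps_nth (dilate a f) i * fps_nth (dilate b g) (n - i)"
  have split: "{0..n} = insert 0 (insert n {1..<n})" using assms(3) by auto
  have "fps_nth (dilate a f * dilate b g) n = ?t 0 + (?t n + (\<Sum>i\<in>{1..<n}. ?t i))"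
    unfolding fps_mult_nth split using assms(3) by (subst sum.insert; simp)+
  also have "(\<Sum>i\<in>{1..<n}. ?t i) = (\<Sum>i\<in>{i\<in>{1..<n}. a dvd i \<and> b dvd n - i}. ?t i)"
    by (rule sum.mono_neutral_right) auto
  also have "\<dots> = (\<Sum>(l, m)\<in>sols a b n. fps_nth f l * fps_nth g m)"
  proof (rule sum.reindex_bij_witness[of _ "\<lambda>(l, m). a * l" "\<lambda>i. (i div a, (n - i) div b)"], goal_cases)
    case (2 i)
    then have i: "a dvd i" "b dvd n - i" "0 < i" "i < n" by auto
    obtain l where l: "i = a * l" using i(1) ..
    obtain m where m: "n - i = b * m" using i(2) ..
    have "0 < a * l" "0 < b * m" "a * l + b * m = n" using i l m by linarith+
    then show ?case using assms l m by (auto simp: sols_def)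
  next
    case (4 t)
    then obtain l m where t: "t = (l, m)" "l > 0" "m > 0" "n = a * l + b * m" by (auto simp: sols_def)
    then have "0 < a * l" "0 < b * m" using assms by simp_all
    then show ?case using t by auto
  next
    case (5 i)
    then show ?case by auto
  qed (use assms in \<open>auto simp: sols_def\<close>)
  finally show ?thesis using assms by (simp add: algebra_simps)
qed

text \<open>This brings S(n/a) into the form of an inner sum of \<open>dilate_mult_nth\<close> with
  both dilations equal to \<open>a\<close>. The solution set is empty unless \<open>a\<close>
  divides \<open>n\<close>, in agreement with the default value 0.\<close>

lemma conv_S_eq_sols:
  assumes "a > 0" "n > 0"
  shows "conv_S (real n / real a) = (\<Sum>(l, m)\<in>sols a a n. l * divisor_sigma 1 l * divisor_sigma 1 m)"
proof (cases "a dvd n")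
  case True
  then obtain k where k: "n = a * k" ..
  then have "k > 0" using assms by simp
  moreover have "sols 1 1 k = sols a a n"
    using assms(1) by (auto simp: sols_def k add_mult_distrib2[symmetric])
  ultimately show ?thesis using assms(1) by (simp add: conv_S_def k div_sigma_of_nat)
next
  case False
  then have "real n / real a \<notin> \<nat>" by (simp add: real_divide_in_Nats_iff[OF assms(1)])
  moreover have "sols a a n = {}"
    using False by (auto simp: sols_def add_mult_distrib2[symmetric])
  ultimately show ?thesis by (simp add: conv_S_def)
qed

section \<open>Derivation rules and the combination of convolution sums\<close>

lemma theta_mult: "theta (f * g) = theta f * g + f * theta g"
  by (simp add: theta_def algebra_simps)

lemma theta_diff: "theta (f - g) = theta f - theta g"
  by (simp add: theta_def algebra_simps)

lemma theta_numeral_mult: "theta (numeral k * f) = numeral k * theta f"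
  by (rule fps_ext) (simp add: fps_mult_numeral_left)

text \<open>
  The coefficients are \<open>3456 a\<^sup>2 b\<close> times the difference of the two sides of the convolution formula
  without its modular part.
\<close>

definition convolution_fps :: "nat \<Rightarrow> nat \<Rightarrow> complex fps" where
  "convolution_fps a b = (let A = of_nat a; B = of_nat b; p = dilate a P_fps; p' = dilate b P_fps in
     fps_const (6 * A * B) * (theta p * p') - fps_const (3 * A * B) * theta (p * p')
     + fps_const (A\<^sup>2 * B / 3) * (p' * dilate a Q_fps) - fps_const (2 * A\<^sup>2) * (theta p * p)
     + fps_const (6 * A) * theta (theta p) + fps_const (6 * B) * theta (theta p'))"

lemma disc_fps_convolution_fps: "a > 0 \<Longrightarrow> b > 0 \<Longrightarrow> disc_fps (convolution_fps a b)"
  by (simp add: convolution_fps_def Let_def)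

text \<open>Ramanujan's identities are solved for the derivatives. For the second derivative,
  applying \<open>theta\<close> to the definition of Q gives \<open>theta (theta P_fps)\<close> in
  terms of \<theta>P and \<theta>Q.\<close>

lemma qeval_theta_P:
  assumes "Im z > 0"
  shows "qeval (theta P_fps) z = (qeval P_fps z ^ 2 - qeval Q_fps z) / 12"
    "qeval (theta (theta P_fps)) z =
       (2 * qeval P_fps z * ((qeval P_fps z ^ 2 - qeval Q_fps z) / 12)
        - (qeval P_fps z * qeval Q_fps z - qeval R_fps z) / 3) / 12"
proof -
  have "qeval Q_fps z = qeval P_fps z * qeval P_fps z - 12 * qeval (theta P_fps) z"
    by (simp add: Q_fps_def qeval_arith[OF assms])
  then show 1: "qeval (theta P_fps) z = (qeval P_fps z ^ 2 - qeval Q_fps z) / 12"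
    by (simp add: power2_eq_square)
  have "qeval R_fps z = qeval P_fps z * qeval Q_fps z - 3 * qeval (theta Q_fps) z"
    by (simp add: R_fps_def qeval_arith[OF assms])
  then have 2: "qeval (theta Q_fps) z = (qeval P_fps z * qeval Q_fps z - qeval R_fps z) / 3" by simp
  have "theta Q_fps = theta P_fps * P_fps + P_fps * theta P_fps - 12 * theta (theta P_fps)"
    by (simp only: Q_fps_def theta_diff theta_numeral_mult) (simp only: theta_mult)
  then have "qeval (theta Q_fps) z = 2 * qeval P_fps z * qeval (theta P_fps) z - 12 * qeval (theta (theta P_fps)) z"
    by (simp add: qeval_arith[OF assms])
  then show "qeval (theta (theta P_fps)) z =
       (2 * qeval P_fps z * ((qeval P_fps z ^ 2 - qeval Q_fps z) / 12)
        - (qeval P_fps z * qeval Q_fps z - qeval R_fps z) / 3) / 12"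
    unfolding 1 2 by (simp add: field_simps)
qed

lemma qeval_convolution_fps:
  assumes "a > 0" "b > 0" "Im z > 0"
  shows "qeval (convolution_fps a b) z = weight6_form a b z"
proof -
  have T: "qeval (theta (dilate k P_fps)) z = of_nat k * qeval (theta P_fps) (of_nat k * z)"
    "qeval (theta (theta (dilate k P_fps))) z = of_nat k ^ 2 * qeval (theta (theta P_fps)) (of_nat k * z)"
    if "k > 0" for k
  proof -
    have "theta (fps_const c * f) = fps_const c * theta f" for c f by (rule fps_ext) simp
    then show "qeval (theta (dilate k P_fps)) z = of_nat k * qeval (theta P_fps) (of_nat k * z)"
      "qeval (theta (theta (dilate k P_fps))) z = of_nat k ^ 2 * qeval (theta (theta P_fps)) (of_nat k * z)"
      using that assms(3) by (simp_all add: theta_dilate qeval_arith qeval_dilate power2_eq_square)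
  qed
  have ab: "Im (of_nat a * z) > 0" "Im (of_nat b * z) > 0" using assms by simp_all
  have "qeval (convolution_fps a b) z =
     6 * of_nat a * of_nat b * (qeval (theta (dilate a P_fps)) z * qeval P_fps (of_nat b * z))
     - 3 * of_nat a * of_nat b * (qeval (theta (dilate a P_fps)) z * qeval P_fps (of_nat b * z)
         + qeval P_fps (of_nat a * z) * qeval (theta (dilate b P_fps)) z)
     + (of_nat a)\<^sup>2 * of_nat b / 3 * (qeval P_fps (of_nat b * z) * qeval Q_fps (of_nat a * z))
     - 2 * (of_nat a)\<^sup>2 * (qeval (theta (dilate a P_fps)) z * qeval P_fps (of_nat a * z))
     + 6 * of_nat a * qeval (theta (theta (dilate a P_fps))) z
     + 6 * of_nat b * qeval (theta (theta (dilate b P_fps))) z"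
    unfolding convolution_fps_def Let_def theta_mult using assms
    by (simp add: qeval_arith qeval_dilate)
  also have "\<dots> = weight6_form a b z"
    unfolding T[OF assms(1)] T[OF assms(2)] qeval_theta_P[OF ab(1)] qeval_theta_P[OF ab(2)] weight6_form_def weight6_poly_def
    using assms(3)
    by (simp add: field_simps power2_eq_square power3_eq_cube)
  finally show ?thesis .
qed

text \<open>The numbers are products of the leading factors of the series: 576 = 24 * 24 for two
  copies of P, and 5760 = 24 * 240 for P with Q. The values of \<sigma> and \<sigma>_3 at
  non-integers are 0, which absorbs the divisibility conditions.\<close>

lemma convolution_fps_nth:
  fixes a b n :: nat
  assumes "a > 0" "b > 0" "n > 0"
  defines "sa \<equiv> of_nat (div_sigma 1 (real n / real a))" and "sb \<equiv> of_nat (div_sigma 1 (real n / real b))"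
    and "s3 \<equiv> of_nat (div_sigma 3 (real n / real a))"
    and "T \<equiv> (\<Sum>(l, m)\<in>sols a b n. of_nat l * of_nat (div_sigma 1 (real l)) * of_nat (div_sigma 1 (real m)))"
    and "W \<equiv> of_nat (conv_W 1 1 a b n)" and "W3 \<equiv> of_nat (conv_W 1 3 b a n)"
    and "S \<equiv> of_nat (conv_S (real n / real a))" and "A \<equiv> of_nat a" and "B \<equiv> of_nat b" and "N \<equiv> of_nat n"
  shows "fps_nth (convolution_fps a b) n =
     6 * A * B * (576 * A * T - 24 * N * sa) - 3 * A * B * (N * (576 * W - 24 * sa - 24 * sb))
     + A\<^sup>2 * B / 3 * (240 * s3 - 24 * sb - 5760 * W3) - 2 * A\<^sup>2 * (576 * A * S - 24 * N * sa)
     + 6 * A * (N\<^sup>2 * (- 24 * sa)) + 6 * B * (N\<^sup>2 * (- 24 * sb))"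
proof -
  let ?s = "\<lambda>n. of_nat (divisor_sigma 1 n) :: complex"
  have dP: "fps_nth (dilate k P_fps) n = - 24 * of_nat (div_sigma 1 (real n / real k))" if "k > 0" for k
    using that assms(3) by (auto simp: div_sigma_div P_fps_nth elim!: dvdE)
  have dQ: "fps_nth (dilate a Q_fps) n = 240 * s3"
    using assms(1,3) by (auto simp: s3_def div_sigma_div Q_fps_nth elim!: dvdE)
  have dT: "fps_nth (dilate a (theta P_fps)) n = N / A * (- 24 * sa)"
    using assms(1,3) by (auto simp: sa_def N_def A_def div_sigma_div P_fps_nth elim!: dvdE)
  have 1: "fps_nth (theta (dilate a P_fps) * dilate b P_fps) n = 576 * A * T - 24 * N * sa"
  proof -
    have e: "fps_nth (theta (dilate a P_fps) * dilate b P_fps) n = A * fps_nth (dilate a (theta P_fps) * dilate b P_fps) n"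
      using assms(1) by (simp add: theta_dilate A_def mult.assoc)
    have "(\<Sum>(l, m)\<in>sols a b n. fps_nth (theta P_fps) l * fps_nth P_fps m) = 576 * T"
      unfolding T_def sum_distrib_left
      by (rule sum.cong) (auto simp: sols_def P_fps_nth div_sigma_of_nat)
    then have "fps_nth (dilate a (theta P_fps) * dilate b P_fps) n = N / A * (- 24 * sa) + 576 * T"
      using dilate_mult_nth[OF assms(1-3), of "theta P_fps" P_fps] unfolding dT by (simp add: P_fps_nth)
    then show ?thesis unfolding e using assms(1) by (simp add: A_def field_simps)
  qed
  have 2: "fps_nth (theta (dilate a P_fps * dilate b P_fps)) n = N * (576 * W - 24 * sa - 24 * sb)"
  proof -
    have "(\<Sum>(l, m)\<in>sols a b n. fps_nth P_fps l * fps_nth P_fps m) = 576 * W"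
      unfolding W_def conv_W_def of_nat_sum sum_distrib_left
      by (rule sum.cong) (auto simp: sols_def P_fps_nth div_sigma_of_nat)
    then show ?thesis
      using dilate_mult_nth[OF assms(1-3), of P_fps P_fps] assms(1,2)
      by (simp add: dP P_fps_nth sa_def sb_def N_def del: dilate_nth)
  qed
  have 3: "fps_nth (dilate b P_fps * dilate a Q_fps) n = 240 * s3 - 24 * sb - 5760 * W3"
  proof -
    have "(\<Sum>(l, m)\<in>sols b a n. fps_nth P_fps l * fps_nth Q_fps m) = - 5760 * W3"
      unfolding W3_def conv_W_def of_nat_sum sum_distrib_left
      by (rule sum.cong) (auto simp: sols_def P_fps_nth Q_fps_nth div_sigma_of_nat)
    then show ?thesis
      using dilate_mult_nth[OF assms(2,1,3), of P_fps Q_fps] assms(1,2)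
      by (simp add: dP dQ P_fps_nth Q_fps_nth sb_def del: dilate_nth)
  qed
  have 4: "fps_nth (theta (dilate a P_fps) * dilate a P_fps) n = 576 * A * S - 24 * N * sa"
  proof -
    have e: "fps_nth (theta (dilate a P_fps) * dilate a P_fps) n = A * fps_nth (dilate a (theta P_fps) * dilate a P_fps) n"
      using assms(1) by (simp add: theta_dilate A_def mult.assoc)
    have "(\<Sum>(l, m)\<in>sols a a n. fps_nth (theta P_fps) l * fps_nth P_fps m) = 576 * S"
      unfolding S_def conv_S_eq_sols[OF assms(1,3)] of_nat_sum sum_distrib_left
      by (rule sum.cong) (auto simp: sols_def P_fps_nth)
    then have "fps_nth (dilate a (theta P_fps) * dilate a P_fps) n = N / A * (- 24 * sa) + 576 * S"
      using dilate_mult_nth[OF assms(1,1,3), of "theta P_fps" P_fps] unfolding dT by (simp add: P_fps_nth)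
    then show ?thesis unfolding e using assms(1) by (simp add: A_def field_simps)
  qed
  have 5: "fps_nth (theta (theta (dilate k P_fps))) n = N\<^sup>2 * (- 24 * of_nat (div_sigma 1 (real n / real k)))"
    if "k > 0" for k
    using dP[OF that] by (simp add: N_def power2_eq_square del: dilate_nth)
  show ?thesis
    unfolding convolution_fps_def Let_def A_def[symmetric] B_def[symmetric]
    by (simp only: fps_add_nth fps_sub_nth fps_mult_left_const_nth 1 2 3 4 5[OF assms(1)] 5[OF assms(2)] sa_def sb_def)
qed

section \<open>Comparison of coefficients with a basis\<close>

lemma sum_scale_fun_apply: "(\<Sum>i\<in>I. scale_fun (c i) (f i)) z = (\<Sum>i\<in>I. c i * f i z)"
  by (induction I rule: infinite_finite_induct) (auto simp: scale_fun_def)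

text \<open>A linear relation between functions on the upper half plane passes to their
  q-expansions, since these are determined by the functions; the coefficients of the relation do not
  depend on \<open>n\<close>.\<close>

lemma basis_fourier_coeff:
  fixes F :: "nat \<Rightarrow> complex \<Rightarrow> complex"
  assumes basis: "is_basis F I (modular_forms k N)" and "finite I"
    and G: "G \<in> modular_forms k N" "disc_fps Gq" "\<And>z. Im z > 0 \<Longrightarrow> G z = qeval Gq z"
  obtains c where "\<And>n. fps_nth Gq n = (\<Sum>i\<in>I. c i * fourier_coeff (F i) n)"
proof -
  have inj: "inj_on F I" and span: "cfun.span (F ` I) = modular_forms k N"
    using basis by (simp_all add: is_basis_def)
  have "G \<in> range (\<lambda>u. \<Sum>v\<in>F ` I. scale_fun (u v) v)"
    using G(1) cfun.span_finite[of "F ` I"] \<open>finite I\<close> by (simp add: span)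
  then obtain u where "G = (\<Sum>v\<in>F ` I. scale_fun (u v) v)" by blast
  also have "\<dots> = (\<Sum>i\<in>I. scale_fun (u (F i)) (F i))" using inj by (simp add: sum.reindex)
  finally have Gsum: "G z = (\<Sum>i\<in>I. u (F i) * F i z)" for z by (simp add: sum_scale_fun_apply)
  have "\<exists>H. disc_fps H \<and> (\<forall>z. Im z > 0 \<longrightarrow> F i z = qeval H z)" if "i \<in> I" for i
  proof -
    have "F i \<in> modular_forms k N" using cfun.span_base[of "F i" "F ` I"] that span by auto
    then show ?thesis using modular_form_q_expansion by metis
  qed
  then obtain H where H: "\<And>i. i \<in> I \<Longrightarrow> disc_fps (H i)" "\<And>i z. i \<in> I \<Longrightarrow> Im z > 0 \<Longrightarrow> F i z = qeval (H i) z"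
    by metis
  have "Gq = (\<Sum>i\<in>I. fps_const (u (F i)) * H i)"
  proof (rule qeval_eqD[OF G(2)])
    show "disc_fps (\<Sum>i\<in>I. fps_const (u (F i)) * H i)" using H(1) by (intro disc_fps_sum) auto
    fix z assume z: "Im z > 0"
    have "qeval (\<Sum>i\<in>I. fps_const (u (F i)) * H i) z = (\<Sum>i\<in>I. qeval (fps_const (u (F i)) * H i) z)"
      using H(1) by (intro qeval_sum z) auto
    also have "\<dots> = (\<Sum>i\<in>I. u (F i) * F i z)"
      by (rule sum.cong) (use H z in \<open>auto simp: qeval_arith\<close>)
    finally show "qeval Gq z = qeval (\<Sum>i\<in>I. fps_const (u (F i)) * H i) z"
      using G(3)[OF z] Gsum by simp
  qed
  moreover have "fps_nth (\<Sum>i\<in>I. fps_const (u (F i)) * H i) n = (\<Sum>i\<in>I. u (F i) * fourier_coeff (F i) n)" for n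
    unfolding fps_sum_nth
    by (rule sum.cong) (simp_all add: fourier_coeff_qeval[OF H])
  ultimately show ?thesis using that[of "\<lambda>i. u (F i)"] by simp
qed

theorem theorem3p5:
  fixes a b :: nat and F :: "nat \<Rightarrow> complex \<Rightarrow> complex"
  assumes "a > 0" and "b > 0" and "gcd a b = 1" and "a > 1 \<or> b > 1"
    and "is_basis F {1..lam 6 (a * b)} (modular_forms 6 (a * b))"
  shows "\<exists>\<delta> :: nat \<Rightarrow> complex. \<forall>n::nat. n \<ge> 2 \<longrightarrow>
    (\<Sum>(l, m)\<in>sols a b n. of_nat l * of_nat (div_sigma 1 (real l)) * of_nat (div_sigma 1 (real m)))
    = 1 / (144 * of_nat a)
        * (6 / of_nat b * of_nat n ^ 2 + 3 * of_nat n - 2 * of_nat a * of_nat n / of_nat b)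
        * of_nat (div_sigma 1 (real n / real a))
    + 1 / (144 * of_nat a)
        * (6 / of_nat a * of_nat n ^ 2 - 3 * of_nat n + of_nat a / 3)
        * of_nat (div_sigma 1 (real n / real b))
    - 5 / 216 * of_nat (div_sigma 3 (real n / real a))
    + of_nat n / (2 * of_nat a) * of_nat (conv_W 1 1 a b n)
    + 5 / 9 * of_nat (conv_W 1 3 b a n)
    + of_nat a / (3 * of_nat b) * of_nat (conv_S (real n / real a))
    + 1 / (6 * 576 * of_nat a)
        * (\<Sum>i = 1..lam 6 (a * b). \<delta> i * fourier_coeff (F i) n)"
proof -
  obtain c where c: "\<And>n. fps_nth (convolution_fps a b) n = (\<Sum>i = 1..lam 6 (a * b). c i * fourier_coeff (F i) n)"
    using basis_fourier_coeff[OF assms(5) finite_atLeastAtMost weight6_form_modular[OF assms(1,2)]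
      disc_fps_convolution_fps[OF assms(1,2)] qeval_convolution_fps[OF assms(1,2), symmetric]] by blast
  \<comment> \<open>The coefficient identity is linear in \<open>T\<close> with leading coefficient
    3456 A^2 B = (6 * 576 * A) * (A * B). The extra factor \<open>A * B\<close> is moved into the
    constants \<delta>, which are therefore \<open>c i\<close> divided by it.\<close>
  have solve: "T = 1 / (144 * A) * (6 / B * N ^ 2 + 3 * N - 2 * A * N / B) * sa
      + 1 / (144 * A) * (6 / A * N ^ 2 - 3 * N + A / 3) * sb - 5 / 216 * s3
      + N / (2 * A) * W + 5 / 9 * W3 + A / (3 * B) * S + 1 / (6 * 576 * A) * (X / (A * B))"
    if "X = 6 * A * B * (576 * A * T - 24 * N * sa) - 3 * A * B * (N * (576 * W - 24 * sa - 24 * sb))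
     + A\<^sup>2 * B / 3 * (240 * s3 - 24 * sb - 5760 * W3) - 2 * A\<^sup>2 * (576 * A * S - 24 * N * sa)
     + 6 * A * (N\<^sup>2 * (- 24 * sa)) + 6 * B * (N\<^sup>2 * (- 24 * sb))" "A \<noteq> 0" "B \<noteq> 0"
    for T A B N sa sb s3 W W3 S X :: complex
    unfolding that(1) using that(2,3) by (simp add: field_simps power2_eq_square)
  show ?thesis
  proof (intro exI allI impI)
    fix n :: nat assume "n \<ge> 2"
    then have n: "n > 0" by simp
    have "(\<Sum>i = 1..lam 6 (a * b). c i / (of_nat a * of_nat b) * fourier_coeff (F i) n) =
       fps_nth (convolution_fps a b) n / (of_nat a * of_nat b)"
      unfolding c by (simp add: sum_divide_distrib)
    then show "(\<Sum>(l, m)\<in>sols a b n. of_nat l * of_nat (div_sigma 1 (real l)) * of_nat (div_sigma 1 (real m)))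
    = 1 / (144 * of_nat a)
        * (6 / of_nat b * of_nat n ^ 2 + 3 * of_nat n - 2 * of_nat a * of_nat n / of_nat b)
        * of_nat (div_sigma 1 (real n / real a))
    + 1 / (144 * of_nat a)
        * (6 / of_nat a * of_nat n ^ 2 - 3 * of_nat n + of_nat a / 3)
        * of_nat (div_sigma 1 (real n / real b))
    - 5 / 216 * of_nat (div_sigma 3 (real n / real a))
    + of_nat n / (2 * of_nat a) * of_nat (conv_W 1 1 a b n)
    + 5 / 9 * of_nat (conv_W 1 3 b a n)
    + of_nat a / (3 * of_nat b) * of_nat (conv_S (real n / real a))
    + 1 / (6 * 576 * of_nat a)
        * (\<Sum>i = 1..lam 6 (a * b). c i / (of_nat a * of_nat b) * fourier_coeff (F i) n)"
      using solve[OF convolution_fps_nth[OF assms(1,2) n]] assms(1,2) by simp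
  qed
qed

end
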